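(* Let $\mu$ be a rotation-invariant positive Borel measure on $\mathbb{C}^n$ ($n\ge1$) such that $m_d=\int_{\mathbb{C}^n}|z|^{2d}\,d\mu$ satisfies $0<m_d<\infty$ for all $d\in\mathbb{N}$. Then the canonical solution operator to $\bar\partial$ is a Hilbert-Schmidt operator on $A^2_{(0,1)}(d\mu)$ if and only if $$\lim_{d\to\infty}\binom{n+d-1}{n-1}\frac{m_{d+1}}{m_d}<\infty .$$
   Context: $\mathbb{N}=\{0,1,2,\dots\}$; $|z|^2=\sum_j|z_j|^2$. Rotation-invariant means invariant under the unitary group $U(n)$; in particular the monomials are pairwise orthogonal in $L^2(d\mu)$. $A^2(d\mu)$ is the closure in $L^2(d\mu)$ of the linear span of the monomials $z^\alpha$, $\alpha\in\mathbb{N}^n$. $A^2_{(0,1)}(d\mu)$ is the Hilbert space of $(0,1)$-forms $\sum_{j=1}^n f_j\,d\bar z_j$ with $f_j\in A^2(d\mu)$, with norm squared $\sum_j\|f_j\|^2_{L^2(d\mu)}$. "$\lim_{d\to\infty}x_d<\infty$" means that the limit exists and is finite. Canonical solution operator $S$: $S\omega$ is the solution $f\in L^2(d\mu)$ of $\bar\partial f=\omega$ that is orthogonal to $A^2(d\mu)$. Concretely, since $\bar\partial(\bar z_j z^\alpha)=z^\alpha d\bar z_j$, on the dense subspace of forms with polynomial coefficients (finite linear combinations of the $z^\alpha d\bar z_j$) $S$ is the linear map for which $S(z^\alpha d\bar z_j)$ is the unique element of $\bar z_j z^\alpha+A^2(d\mu)$ orthogonal to $A^2(d\mu)$. "Hilbert-Schmidt"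 means that this densely defined map extends to a Hilbert-Schmidt operator $A^2_{(0,1)}(d\mu)\to L^2(d\mu)$. *)

theory Defs
  imports "HOL-Analysis.Analysis"
begin

definition conj_transpose :: "complex ^ 'n ^ 'n \<Rightarrow> complex ^ 'n ^ 'n" where
  "conj_transpose U = (\<chi> i j. cnj (U $ j $ i))"

definition unitary :: "complex ^ 'n ^ 'n \<Rightarrow> bool" where
  "unitary U \<longleftrightarrow> conj_transpose U ** U = mat 1 \<and> U ** conj_transpose U = mat 1"

definition rotation_invariant :: "(complex ^ 'n) measure \<Rightarrow> bool" where
  "rotation_invariant \<mu> \<longleftrightarrow> (\<forall>U. unitary U \<longrightarrow> distr \<mu> borel (\<lambda>z. U *v z) = \<mu>)"

definition moment :: "(complex ^ 'n) measure \<Rightarrow> nat \<Rightarrow> real" where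
  "moment \<mu> d = (LINT z|\<mu>. norm z ^ (2 * d))"

text \<open>
  Elements of \<open>L\<^sup>2\<close> are represented by functions. No quotient is taken, so the inner product is
  only semidefinite, and equations between elements of \<open>L\<^sup>2\<close> are stated almost everywhere.
\<close>

definition L2 :: "'a measure \<Rightarrow> ('a \<Rightarrow> complex) set" where
  "L2 M = {f. f \<in> borel_measurable M \<and> integrable M (\<lambda>x. (cmod (f x))\<^sup>2)}"

definition L2_inner :: "'a measure \<Rightarrow> ('a \<Rightarrow> complex) \<Rightarrow> ('a \<Rightarrow> complex) \<Rightarrow> complex" where
  "L2_inner M f g = (LINT x|M. f x * cnj (g x))"

definition L2_norm :: "'a measure \<Rightarrow> ('a \<Rightarrow> complex) \<Rightarrow> real" where
  "L2_norm M f = sqrt (LINT x|M. (cmod (f x))\<^sup>2)"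

definition monomial :: "('n \<Rightarrow> nat) \<Rightarrow> complex ^ 'n \<Rightarrow> complex" where
  "monomial \<alpha> z = (\<Prod>j\<in>UNIV. (z $ j) ^ \<alpha> j)"

definition polynomials :: "(complex ^ 'n \<Rightarrow> complex) set" where
  "polynomials = {p. \<exists>A c. finite A \<and> p = (\<lambda>z. \<Sum>\<alpha>\<in>A. c \<alpha> * monomial \<alpha> z)}"

definition A2 :: "(complex ^ 'n) measure \<Rightarrow> (complex ^ 'n \<Rightarrow> complex) set" where
  "A2 \<mu> = {f \<in> L2 \<mu>. \<forall>\<epsilon>>0. \<exists>p\<in>polynomials. L2_norm \<mu> (\<lambda>z. f z - p z) < \<epsilon>}"

text \<open>A \<open>(0,1)\<close>-form is represented by the family of its coefficients with respect to the
  differentials of the conjugate coordinates.\<close>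

type_synonym 'n form01 = "'n \<Rightarrow> complex ^ 'n \<Rightarrow> complex"

definition A2_01 :: "(complex ^ 'n) measure \<Rightarrow> 'n form01 set" where
  "A2_01 \<mu> = {\<omega>. \<forall>j. \<omega> j \<in> A2 \<mu>}"

definition inner01 :: "(complex ^ 'n) measure \<Rightarrow> 'n form01 \<Rightarrow> 'n form01 \<Rightarrow> complex" where
  "inner01 \<mu> \<omega> \<eta> = (\<Sum>j\<in>UNIV. L2_inner \<mu> (\<omega> j) (\<eta> j))"

definition norm01 :: "(complex ^ 'n) measure \<Rightarrow> 'n form01 \<Rightarrow> real" where
  "norm01 \<mu> \<omega> = sqrt (\<Sum>j\<in>UNIV. (L2_norm \<mu> (\<omega> j))\<^sup>2)"

definition monomial_form :: "('n::finite \<Rightarrow> nat) \<Rightarrow> 'n \<Rightarrow> 'n form01" where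
  "monomial_form \<alpha> j = (\<lambda>k z. if k = j then monomial \<alpha> z else 0)"

definition polynomial_forms :: "('n::finite) form01 set" where
  "polynomial_forms = {\<omega>. \<forall>j. \<omega> j \<in> polynomials}"

definition linear_operator_on ::
  "(complex ^ 'n) measure \<Rightarrow> 'n form01 set \<Rightarrow> ('n form01 \<Rightarrow> complex ^ 'n \<Rightarrow> complex) \<Rightarrow> bool" where
  "linear_operator_on \<mu> D T \<longleftrightarrow>
     (\<forall>\<omega>\<in>D. T \<omega> \<in> L2 \<mu>) \<and>
     (\<forall>\<omega>\<in>D. \<forall>\<eta>\<in>D. \<forall>a b. AE z in \<mu>.
        T (\<lambda>j w. a * \<omega> j w + b * \<eta> j w) z = a * T \<omega> z + b * T \<eta> z)"

text \<open>The canonical solution operator is determined up to equality almost everywhere on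
  polynomial forms; its values on other forms are irrelevant.\<close>

definition is_canonical_solution_operator ::
  "(complex ^ 'n) measure \<Rightarrow> ('n form01 \<Rightarrow> complex ^ 'n \<Rightarrow> complex) \<Rightarrow> bool" where
  "is_canonical_solution_operator \<mu> S \<longleftrightarrow>
     linear_operator_on \<mu> polynomial_forms S \<and>
     (\<forall>\<alpha> j. (\<lambda>z. S (monomial_form \<alpha> j) z - cnj (z $ j) * monomial \<alpha> z) \<in> A2 \<mu> \<and>
            (\<forall>g\<in>A2 \<mu>. L2_inner \<mu> (S (monomial_form \<alpha> j)) g = 0))"

definition canonical_solution_operator ::
  "(complex ^ 'n) measure \<Rightarrow> 'n form01 \<Rightarrow> complex ^ 'n \<Rightarrow> complex" where
  "canonical_solution_operator \<mu> = (SOME S. is_canonical_solution_operator \<mu> S)"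

definition orthonormal_basis_A2_01 :: "(complex ^ 'n) measure \<Rightarrow> 'n form01 set \<Rightarrow> bool" where
  "orthonormal_basis_A2_01 \<mu> E \<longleftrightarrow>
     E \<subseteq> A2_01 \<mu> \<and>
     (\<forall>e\<in>E. \<forall>e'\<in>E. inner01 \<mu> e e' = (if e = e' then 1 else 0)) \<and>
     (\<forall>\<omega>\<in>A2_01 \<mu>. \<forall>\<epsilon>>0. \<exists>F c. finite F \<and> F \<subseteq> E \<and>
        norm01 \<mu> (\<lambda>j z. \<omega> j z - (\<Sum>e\<in>F. c e * e j z)) < \<epsilon>)"

text \<open>Linearity and boundedness together imply that \<open>T\<close> respects equality almost everywhere,
  hence descends to an operator between the Hilbert spaces.\<close>

definition hilbert_schmidt_operator ::
  "(complex ^ 'n) measure \<Rightarrow> ('n form01 \<Rightarrow> complex ^ 'n \<Rightarrow> complex) \<Rightarrow> bool" where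
  "hilbert_schmidt_operator \<mu> T \<longleftrightarrow>
     linear_operator_on \<mu> (A2_01 \<mu>) T \<and>
     (\<exists>C. \<forall>\<omega>\<in>A2_01 \<mu>. L2_norm \<mu> (T \<omega>) \<le> C * norm01 \<mu> \<omega>) \<and>
     (\<exists>E. orthonormal_basis_A2_01 \<mu> E \<and> (\<lambda>e. (L2_norm \<mu> (T e))\<^sup>2) summable_on E)"

definition extends_to_hilbert_schmidt ::
  "(complex ^ 'n) measure \<Rightarrow> ('n form01 \<Rightarrow> complex ^ 'n \<Rightarrow> complex) \<Rightarrow> bool" where
  "extends_to_hilbert_schmidt \<mu> S \<longleftrightarrow>
     (\<exists>T. hilbert_schmidt_operator \<mu> T \<and>
          (\<forall>\<omega>\<in>polynomial_forms. AE z in \<mu>. T \<omega> z = S \<omega> z))"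

end

theory Submission
  imports Defs
begin

text \<open>
  Orthogonality of the monomials gives the solution for the form \<open>z\<^sup>\<alpha> d\<zeta>\<^sub>j\<close>, where \<open>\<zeta>\<^sub>j\<close> is the
  conjugate of \<open>z\<^sub>j\<close>: it is \<open>\<zeta>\<^sub>j z\<^sup>\<alpha> - t z\<^bsup>\<alpha> - e\<^sub>j\<^esup>\<close> with \<open>t = c(\<alpha>) / c(\<alpha> - e\<^sub>j)\<close>, where
  \<open>c(\<alpha>)\<close> is the squared norm of \<open>z\<^sup>\<alpha>\<close> (the constant \<open>sqnorm \<alpha>\<close>), and \<open>t = 0\<close> if \<open>\<alpha>\<^sub>j = 0\<close>. For
  the normalized form the squared norm of the solution is
  \<open>c(\<alpha> + e\<^sub>j) / c(\<alpha>) - c(\<alpha>) / c(\<alpha> - e\<^sub>j)\<close>. Summed over \<open>j\<close> and over all \<open>\<alpha>\<close> of degree at most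
  \<open>d\<close>, these terms telescope, and only the sum of \<open>c(\<alpha> + e\<^sub>j) / c(\<alpha>)\<close> over \<open>\<bar>\<alpha>\<bar> = d\<close> and \<open>j\<close>
  survives (\<open>sum_hs_term\<close>).

  Invariance under rotations of two coordinates shows that \<open>c(\<alpha>) / \<alpha>!\<close> depends only on \<open>\<bar>\<alpha>\<bar>\<close>
  (\<open>sqnorm_formula\<close>). Hence the sum over \<open>j\<close> of \<open>c(\<alpha> + e\<^sub>j) / c(\<alpha>)\<close> is \<open>m\<^bsub>d+1\<^esub> / m\<^sub>d\<close> for
  every \<open>\<alpha>\<close> of degree \<open>d\<close> (\<open>sqnorm_shift_ratio\<close>), and the number of such \<open>\<alpha>\<close> is the binomial
  coefficient (\<open>card_degree_set\<close>). So the sequence in the criterion is exactly the increasing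
  sequence of partial sums of the Hilbert-Schmidt sum over the normalized monomial forms.

  It remains to relate these sums to the existence of a Hilbert-Schmidt extension. If there is an
  extension whose Hilbert-Schmidt sum is finite in some orthonormal basis, then that sum bounds
  the sum over every orthonormal family (\<open>hilbert_schmidt_sum_le\<close>). If the partial sums are
  bounded, then the operator is bounded on polynomial forms and extends continuously by
  completeness of \<open>L\<^sup>2\<close> (\<open>canonical_solution_bounded_extension\<close>).
\<close>

section \<open>The semi-inner product on square-integrable functions\<close>

lemma L2_measurable [measurable_dest]: "f \<in> L2 M \<Longrightarrow> f \<in> borel_measurable M"
  by (simp add: L2_def)

lemma L2_integrable_square: "f \<in> L2 M \<Longrightarrow> integrable M (\<lambda>x. (cmod (f x))\<^sup>2)"
  by (simp add: L2_def)

lemma L2_norm_nonneg [simp]: "0 \<le> L2_norm M f"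
  by (simp add: L2_norm_def)

lemma L2_norm_power2: "(L2_norm M f)\<^sup>2 = (LINT x|M. (cmod (f x))\<^sup>2)"
  by (simp add: L2_norm_def)

lemma L2_norm_cong_AE:
  assumes "f \<in> L2 M" "g \<in> L2 M" "AE x in M. f x = g x"
  shows "L2_norm M f = L2_norm M g"
  unfolding L2_norm_def using assms
  by (intro arg_cong[where f=sqrt] integral_cong_AE) (auto dest!: L2_measurable)

lemma L2_zero [simp]: "(\<lambda>x. 0) \<in> L2 M"
  by (simp add: L2_def)

lemma L2_norm_zero [simp]: "L2_norm M (\<lambda>x. 0) = 0"
  by (simp add: L2_norm_def)

lemma L2_norm_minus_commute: "L2_norm M (\<lambda>x. f x - g x) = L2_norm M (\<lambda>x. g x - f x)"
  by (simp add: L2_norm_def norm_minus_commute)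

lemma L2_cmult [simp]:
  assumes "f \<in> L2 M"
  shows "(\<lambda>x. c * f x) \<in> L2 M"
  using assms by (auto simp: L2_def norm_mult power_mult_distrib)

lemma L2_add [simp]:
  assumes "f \<in> L2 M" "g \<in> L2 M"
  shows "(\<lambda>x. f x + g x) \<in> L2 M"
proof -
  have [measurable]: "f \<in> borel_measurable M" "g \<in> borel_measurable M"
    using assms by (auto simp: L2_def)
  have bound: "(cmod (a + b))\<^sup>2 \<le> 2 * (cmod a)\<^sup>2 + 2 * (cmod b)\<^sup>2" for a b
  proof -
    have "(cmod (a + b))\<^sup>2 \<le> (cmod a + cmod b)\<^sup>2"
      by (intro power_mono norm_triangle_ineq norm_ge_zero)
    also have "\<dots> \<le> 2 * (cmod a)\<^sup>2 + 2 * (cmod b)\<^sup>2"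
      using sum_squares_bound[of "cmod a" "cmod b"] unfolding power2_sum by linarith
    finally show ?thesis .
  qed
  have "integrable M (\<lambda>x. (cmod (f x + g x))\<^sup>2)"
  proof (rule Bochner_Integration.integrable_bound)
    show "integrable M (\<lambda>x. 2 * (cmod (f x))\<^sup>2 + 2 * (cmod (g x))\<^sup>2)"
      using assms by (simp add: L2_integrable_square)
    show "AE x in M. norm ((cmod (f x + g x))\<^sup>2) \<le> norm (2 * (cmod (f x))\<^sup>2 + 2 * (cmod (g x))\<^sup>2)"
      by (rule AE_I2) (simp add: bound)
  qed simp
  then show ?thesis
    by (simp add: L2_def)
qed

lemma L2_diff [simp]:
  assumes "f \<in> L2 M" "g \<in> L2 M"
  shows "(\<lambda>x. f x - g x) \<in> L2 M"
  using L2_add[OF assms(1) L2_cmult[OF assms(2), of "-1"]] by simp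

lemma L2_sum [simp]:
  assumes "\<And>k. k \<in> K \<Longrightarrow> f k \<in> L2 M"
  shows "(\<lambda>x. \<Sum>k\<in>K. f k x) \<in> L2 M"
  using assms by (induction K rule: infinite_finite_induct) auto

lemma borel_measurable_cnj:
  assumes "f \<in> borel_measurable M"
  shows "(\<lambda>x. cnj (f x)) \<in> borel_measurable M"
  by (rule measurable_compose[OF assms borel_measurable_continuous_onI])
    (rule continuous_on_cnj[OF continuous_on_id])

lemma L2_product_integrable:
  assumes "f \<in> L2 M" "g \<in> L2 M"
  shows "integrable M (\<lambda>x. f x * cnj (g x))"
proof -
  have [measurable]: "f \<in> borel_measurable M" "g \<in> borel_measurable M"
    using assms by (auto simp: L2_def)
  have bound: "cmod (f x * cnj (g x)) \<le> (cmod (f x))\<^sup>2 + (cmod (g x))\<^sup>2" for x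
    using sum_squares_bound[of "cmod (f x)" "cmod (g x)"]
      mult_nonneg_nonneg[OF norm_ge_zero norm_ge_zero, of "f x" "g x"]
    unfolding norm_mult complex_mod_cnj by linarith
  show ?thesis
  proof (rule Bochner_Integration.integrable_bound)
    show "integrable M (\<lambda>x. (cmod (f x))\<^sup>2 + (cmod (g x))\<^sup>2)"
      using assms by (simp add: L2_integrable_square)
    show "AE x in M. norm (f x * cnj (g x)) \<le> norm ((cmod (f x))\<^sup>2 + (cmod (g x))\<^sup>2)"
      by (rule AE_I2) (simp add: bound del: norm_mult)
    show "(\<lambda>x. f x * cnj (g x)) \<in> borel_measurable M"
      by (rule borel_measurable_times)
        (simp_all add: borel_measurable_cnj)
  qed
qed

lemma L2_inner_self: "L2_inner M f f = of_real ((L2_norm M f)\<^sup>2)"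
proof -
  have "f x * cnj (f x) = of_real ((cmod (f x))\<^sup>2)" for x
    by (rule complex_norm_square[symmetric])
  then show ?thesis
    by (simp only: L2_inner_def L2_norm_power2 integral_complex_of_real)
qed

lemma L2_inner_commute: "L2_inner M g f = cnj (L2_inner M f g)"
  by (simp add: L2_inner_def mult.commute flip: Bochner_Integration.integral_cnj)

lemma L2_inner_cmult_left [simp]: "L2_inner M (\<lambda>x. c * f x) g = c * L2_inner M f g"
  by (simp add: L2_inner_def mult.assoc)

lemma L2_inner_cmult_right [simp]: "L2_inner M f (\<lambda>x. c * g x) = cnj c * L2_inner M f g"
  by (simp add: L2_inner_def mult.assoc mult.left_commute)

lemma L2_inner_add_left:
  assumes "f \<in> L2 M" "g \<in> L2 M" "h \<in> L2 M"
  shows "L2_inner M (\<lambda>x. f x + g x) h = L2_inner M f h + L2_inner M g h"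
  using assms by (simp add: L2_inner_def distrib_right L2_product_integrable)

lemma L2_inner_diff_left:
  assumes "f \<in> L2 M" "g \<in> L2 M" "h \<in> L2 M"
  shows "L2_inner M (\<lambda>x. f x - g x) h = L2_inner M f h - L2_inner M g h"
  using assms by (simp add: L2_inner_def left_diff_distrib L2_product_integrable)

lemma L2_inner_diff_right:
  assumes "f \<in> L2 M" "g \<in> L2 M" "h \<in> L2 M"
  shows "L2_inner M h (\<lambda>x. f x - g x) = L2_inner M h f - L2_inner M h g"
  using assms by (simp add: L2_inner_def right_diff_distrib L2_product_integrable)

lemma L2_inner_sum_left:
  assumes "\<And>k. k \<in> K \<Longrightarrow> f k \<in> L2 M" "h \<in> L2 M"
  shows "L2_inner M (\<lambda>x. \<Sum>k\<in>K. f k x) h = (\<Sum>k\<in>K. L2_inner M (f k) h)"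
  using assms by (simp add: L2_inner_def sum_distrib_right L2_product_integrable)

lemma L2_inner_sum_right:
  assumes "\<And>k. k \<in> K \<Longrightarrow> f k \<in> L2 M" "h \<in> L2 M"
  shows "L2_inner M h (\<lambda>x. \<Sum>k\<in>K. f k x) = (\<Sum>k\<in>K. L2_inner M h (f k))"
  using assms by (simp add: L2_inner_def sum_distrib_left L2_product_integrable)

text \<open>
  The discriminant of the nonnegative quadratic polynomial \<open>t \<mapsto> \<integral>(\<bar>f\<bar> - t\<bar>g\<bar>)\<^sup>2\<close>. This
  form with absolute values under the integral also yields the triangle inequality and, for
  \<open>g = 1\<close>, the comparison of the \<open>L\<^sup>1\<close> and \<open>L\<^sup>2\<close> norms.
\<close>
lemma L2_Cauchy_Schwarz_real:
  assumes "f \<in> L2 M" "g \<in> L2 M"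
  shows "(LINT x|M. cmod (f x) * cmod (g x)) \<le> L2_norm M f * L2_norm M g"
proof -
  define A B C where "A = (LINT x|M. (cmod (f x))\<^sup>2)" and "B = (LINT x|M. (cmod (g x))\<^sup>2)"
    and "C = (LINT x|M. cmod (f x) * cmod (g x))"
  have int: "integrable M (\<lambda>x. cmod (f x) * cmod (g x))"
    using integrable_norm[OF L2_product_integrable[OF assms]] by (simp add: norm_mult)
  have "0 \<le> A" "0 \<le> B" "0 \<le> C"
    by (auto simp: A_def B_def C_def)
  have quad: "0 \<le> A - 2 * t * C + t\<^sup>2 * B" for t
  proof -
    have "0 \<le> (LINT x|M. (cmod (f x) - t * cmod (g x))\<^sup>2)"
      by simp
    also have "\<dots> = (LINT x|M. (cmod (f x))\<^sup>2 - 2 * t * (cmod (f x) * cmod (g x))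
        + t\<^sup>2 * (cmod (g x))\<^sup>2)"
      by (intro Bochner_Integration.integral_cong) (auto simp: power2_diff power_mult_distrib)
    also have "\<dots> = A - 2 * t * C + t\<^sup>2 * B"
      using assms int by (simp add: A_def B_def C_def L2_integrable_square)
    finally show ?thesis .
  qed
  have "C\<^sup>2 \<le> A * B"
  proof (cases "B = 0")
    case True
    have "C = 0"
    proof (rule ccontr)
      assume "C \<noteq> 0"
      then show False
        using quad[of "(A + 1) / (2 * C)"] True by simp
    qed
    then show ?thesis
      using \<open>0 \<le> A\<close> \<open>0 \<le> B\<close> by simp
  next
    case False
    then have "0 < B" using \<open>0 \<le> B\<close> by simp
    have "0 \<le> B * (A - 2 * (C / B) * C + (C / B)\<^sup>2 * B)"
      using quad[of "C / B"] \<open>0 < B\<close> by simp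
    also have "\<dots> = A * B - C\<^sup>2"
      using \<open>0 < B\<close> by (simp add: field_simps power2_eq_square)
    finally show ?thesis by simp
  qed
  then have "C \<le> sqrt (A * B)"
    by (simp add: real_le_rsqrt)
  then show ?thesis
    by (simp add: A_def B_def C_def L2_norm_def real_sqrt_mult)
qed

lemma L2_Cauchy_Schwarz:
  assumes "f \<in> L2 M" "g \<in> L2 M"
  shows "cmod (L2_inner M f g) \<le> L2_norm M f * L2_norm M g"
proof -
  have "cmod (L2_inner M f g) \<le> (LINT x|M. cmod (f x) * cmod (g x))"
    unfolding L2_inner_def by (rule order_trans[OF integral_norm_bound]) (simp add: norm_mult)
  then show ?thesis
    using L2_Cauchy_Schwarz_real[OF assms] by simp
qed

lemma L2_norm_cmult: "L2_norm M (\<lambda>x. c * f x) = cmod c * L2_norm M f"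
  by (simp add: L2_norm_def norm_mult power_mult_distrib real_sqrt_mult)

lemma L2_norm_triangle:
  assumes "f \<in> L2 M" "g \<in> L2 M"
  shows "L2_norm M (\<lambda>x. f x + g x) \<le> L2_norm M f + L2_norm M g"
proof -
  have int: "integrable M (\<lambda>x. cmod (f x) * cmod (g x))"
    using integrable_norm[OF L2_product_integrable[OF assms]] by (simp add: norm_mult)
  have "(L2_norm M (\<lambda>x. f x + g x))\<^sup>2 \<le> (LINT x|M. (cmod (f x) + cmod (g x))\<^sup>2)"
    unfolding L2_norm_power2
  proof (rule integral_mono)
    show "integrable M (\<lambda>x. (cmod (f x) + cmod (g x))\<^sup>2)"
      using assms int by (simp add: power2_sum L2_integrable_square mult.assoc)
  qed (simp_all add: assms L2_integrable_square norm_triangle_ineq power_mono)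
  also have "\<dots> = (L2_norm M f)\<^sup>2 + (L2_norm M g)\<^sup>2 + 2 * (LINT x|M. cmod (f x) * cmod (g x))"
    using assms int by (simp add: power2_sum L2_norm_power2 L2_integrable_square mult.assoc)
  also have "\<dots> \<le> (L2_norm M f + L2_norm M g)\<^sup>2"
    using L2_Cauchy_Schwarz_real[OF assms] by (simp add: power2_sum)
  finally show ?thesis
    by (rule power2_le_imp_le) simp
qed

lemma L2_norm_triangle_diff:
  assumes "f \<in> L2 M" "g \<in> L2 M" "h \<in> L2 M"
  shows "L2_norm M (\<lambda>x. f x - h x) \<le> L2_norm M (\<lambda>x. f x - g x) + L2_norm M (\<lambda>x. g x - h x)"
  using L2_norm_triangle[of "\<lambda>x. f x - g x" M "\<lambda>x. g x - h x"] assms by simp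

lemma L2_norm_eq_0_AE:
  assumes "f \<in> L2 M" "L2_norm M f = 0"
  shows "AE x in M. f x = 0"
proof -
  have "(LINT x|M. (cmod (f x))\<^sup>2) = 0"
    using assms(2) by (simp flip: L2_norm_power2)
  then have "AE x in M. (cmod (f x))\<^sup>2 = 0"
    using integral_nonneg_eq_0_iff_AE[OF L2_integrable_square[OF assms(1)]] by simp
  then show ?thesis by simp
qed

text \<open>
  On a finite measure space an \<open>L\<^sup>2\<close>-Cauchy sequence is \<open>L\<^sup>1\<close>-Cauchy by
  the Cauchy-Schwarz inequality, hence has an almost everywhere convergent subsequence; Fatou's
  lemma shows that its pointwise limit is also the limit in \<open>L\<^sup>2\<close>.
\<close>

lemma L2_complete:
  assumes "finite_measure M" and s: "\<And>n. s n \<in> L2 M"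
    and Cauchy: "\<And>\<epsilon>. 0 < \<epsilon> \<Longrightarrow> \<exists>N. \<forall>m\<ge>N. \<forall>n\<ge>N. L2_norm M (\<lambda>x. s m x - s n x) < \<epsilon>"
  obtains f where "f \<in> L2 M" "(\<lambda>n. L2_norm M (\<lambda>x. f x - s n x)) \<longlonglongrightarrow> 0"
proof -
  interpret finite_measure M by fact
  have [measurable]: "s n \<in> borel_measurable M" for n
    using s by (auto simp: L2_def)
  have one: "(\<lambda>x. 1) \<in> L2 M"
    by (simp add: L2_def)
  have L1_le: "(LINT x|M. cmod (g x)) \<le> L2_norm M g * L2_norm M (\<lambda>x. 1)" if "g \<in> L2 M" for g
    using L2_Cauchy_Schwarz_real[OF that one] by simp
  have integrable: "integrable M g" if "g \<in> L2 M" for g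
    using L2_product_integrable[OF that one] by simp
  have "\<exists>N. \<forall>i\<ge>N. \<forall>j\<ge>N. (LINT x|M. norm (s i x - s j x)) < \<epsilon>" if "0 < \<epsilon>" for \<epsilon>
  proof -
    define c where "c = L2_norm M (\<lambda>x. 1) + 1"
    have "0 < c" by (simp add: c_def add_nonneg_pos)
    then obtain N where N: "\<forall>m\<ge>N. \<forall>n\<ge>N. L2_norm M (\<lambda>x. s m x - s n x) < \<epsilon> / c"
      using Cauchy[of "\<epsilon> / c"] \<open>0 < \<epsilon>\<close> by auto
    have "(LINT x|M. norm (s i x - s j x)) < \<epsilon>" if "N \<le> i" "N \<le> j" for i j
    proof -
      have "(LINT x|M. norm (s i x - s j x)) \<le> L2_norm M (\<lambda>x. s i x - s j x) * c"
        using L1_le[OF L2_diff[OF s s], of i j] by (simp add: c_def algebra_simps add_increasing)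
      also have "\<dots> < \<epsilon>"
        using N that \<open>0 < c\<close> by (simp add: field_simps)
      finally show ?thesis .
    qed
    then show ?thesis by blast
  qed
  then obtain r where r: "strict_mono r" and AE_Cauchy: "AE x in M. Cauchy (\<lambda>i. s (r i) x)"
    using cauchy_L1_AE_cauchy_subseq[of M s] integrable[OF s] by blast
  define f where "f x = lim (\<lambda>i. s (r i) x)" for x
  have [measurable]: "f \<in> borel_measurable M"
    unfolding f_def by measurable
  have AE_lim: "AE x in M. (\<lambda>i. s (r i) x) \<longlonglongrightarrow> f x"
    using AE_Cauchy by eventually_elim (simp add: f_def Cauchy_convergent_iff convergent_LIMSEQ_iff)
  have Fatou: "(\<integral>\<^sup>+ x. ennreal ((cmod (f x - s m x))\<^sup>2) \<partial>M) \<le> ennreal (\<epsilon>\<^sup>2)"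
    if "\<forall>m\<ge>N. \<forall>n\<ge>N. L2_norm M (\<lambda>x. s m x - s n x) < \<epsilon>" "N \<le> m" "0 < \<epsilon>" for \<epsilon> N m
  proof -
    \<comment> \<open>replace \<open>f\<close> by the limit of the subsequence in order to apply Fatou's lemma\<close>
    have "(\<integral>\<^sup>+ x. ennreal ((cmod (f x - s m x))\<^sup>2) \<partial>M)
        = (\<integral>\<^sup>+ x. liminf (\<lambda>i. ennreal ((cmod (s (r i) x - s m x))\<^sup>2)) \<partial>M)"
    proof (rule nn_integral_cong_AE)
      show "AE x in M. ennreal ((cmod (f x - s m x))\<^sup>2)
          = liminf (\<lambda>i. ennreal ((cmod (s (r i) x - s m x))\<^sup>2))"
        using AE_lim
      proof eventually_elim
        case (elim x)
        have "(\<lambda>i. ennreal ((cmod (s (r i) x - s m x))\<^sup>2)) \<longlonglongrightarrow> ennreal ((cmod (f x - s m x))\<^sup>2)"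
          by (intro tendsto_ennrealI tendsto_intros elim)
        then show ?case
          by (intro lim_imp_Liminf[symmetric]) simp_all
      qed
    qed
    also have "\<dots> \<le> liminf (\<lambda>i. \<integral>\<^sup>+ x. ennreal ((cmod (s (r i) x - s m x))\<^sup>2) \<partial>M)"
      by (rule nn_integral_liminf) simp
    also have "\<dots> \<le> ennreal (\<epsilon>\<^sup>2)"
    proof (rule Liminf_le)
      show "\<forall>\<^sub>F i in sequentially. (\<integral>\<^sup>+ x. ennreal ((cmod (s (r i) x - s m x))\<^sup>2) \<partial>M) \<le> ennreal (\<epsilon>\<^sup>2)"
        using eventually_ge_at_top[of N]
      proof eventually_elim
        case (elim i)
        have "N \<le> r i"
          using elim seq_suble[OF r, of i] by simp
        then have "(L2_norm M (\<lambda>x. s (r i) x - s m x))\<^sup>2 \<le> \<epsilon>\<^sup>2"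
          using that by (intro power_mono) (auto intro: less_imp_le)
        then show ?case
          by (simp add: L2_norm_power2 nn_integral_eq_integral L2_integrable_square s ennreal_leI)
      qed
    qed simp
    finally show ?thesis .
  qed
  have L2_diff_le: "(\<lambda>x. f x - s m x) \<in> L2 M \<and> L2_norm M (\<lambda>x. f x - s m x) \<le> \<epsilon>"
    if "\<forall>m\<ge>N. \<forall>n\<ge>N. L2_norm M (\<lambda>x. s m x - s n x) < \<epsilon>" "N \<le> m" "0 < \<epsilon>" for \<epsilon> N m
  proof
    have "integrable M (\<lambda>x. (cmod (f x - s m x))\<^sup>2)"
    proof (rule integrableI_bounded)
      show "(\<integral>\<^sup>+ x. ennreal (norm ((cmod (f x - s m x))\<^sup>2)) \<partial>M) < \<infinity>"
        using order.strict_trans1[OF Fatou[OF that] ennreal_less_top] by simp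
    qed simp
    then show L2: "(\<lambda>x. f x - s m x) \<in> L2 M"
      by (simp add: L2_def)
    have "ennreal ((L2_norm M (\<lambda>x. f x - s m x))\<^sup>2) \<le> ennreal (\<epsilon>\<^sup>2)"
      using Fatou[OF that] L2 by (simp add: L2_norm_power2 nn_integral_eq_integral L2_def)
    then have "(L2_norm M (\<lambda>x. f x - s m x))\<^sup>2 \<le> \<epsilon>\<^sup>2"
      by simp
    then show "L2_norm M (\<lambda>x. f x - s m x) \<le> \<epsilon>"
      by (rule power2_le_imp_le) (use \<open>0 < \<epsilon>\<close> in simp)
  qed
  show ?thesis
  proof
    obtain N where "\<forall>m\<ge>N. \<forall>n\<ge>N. L2_norm M (\<lambda>x. s m x - s n x) < 1"
      using Cauchy[of 1] by auto
    then have "(\<lambda>x. f x - s N x) \<in> L2 M"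
      using L2_diff_le[of N 1 N] by simp
    then show "f \<in> L2 M"
      using L2_add[OF _ s, of "\<lambda>x. f x - s N x" N] by simp
    show "(\<lambda>n. L2_norm M (\<lambda>x. f x - s n x)) \<longlonglongrightarrow> 0"
    proof (rule LIMSEQ_I)
      fix e :: real assume "0 < e"
      then obtain N where "\<forall>m\<ge>N. \<forall>n\<ge>N. L2_norm M (\<lambda>x. s m x - s n x) < e / 2"
        using Cauchy[of "e / 2"] by auto
      then have "\<forall>n\<ge>N. norm (L2_norm M (\<lambda>x. f x - s n x) - 0) < e"
        using L2_diff_le[of N "e / 2"] \<open>0 < e\<close> by fastforce
      then show "\<exists>N. \<forall>n\<ge>N. norm (L2_norm M (\<lambda>x. f x - s n x) - 0) < e" ..
    qed
  qed
qed

section \<open>Monomials\<close>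

lemma monomial_upd: "monomial (\<alpha>(i := k)) z = (z $ i) ^ k * monomial (\<alpha>(i := 0)) z"
proof -
  have "(\<Prod>a\<in>UNIV - {i}. (z $ a) ^ (\<alpha>(i := k)) a) = (\<Prod>a\<in>UNIV - {i}. (z $ a) ^ (\<alpha>(i := 0)) a)"
    by (rule prod.cong) auto
  then show ?thesis
    by (simp add: monomial_def prod.remove[of UNIV i])
qed

lemma monomial_Suc: "monomial (\<alpha>(j := Suc (\<alpha> j))) z = z $ j * monomial \<alpha> z"
  using monomial_upd[of \<alpha> j "Suc (\<alpha> j)" z] monomial_upd[of \<alpha> j "\<alpha> j" z]
  by (simp add: mult.assoc)

lemma monomial_cong:
  assumes "\<And>a. \<alpha> a \<noteq> 0 \<Longrightarrow> z $ a = w $ a"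
  shows "monomial \<alpha> z = monomial \<alpha> w"
  unfolding monomial_def using assms by (intro prod.cong refl) (metis power_0)

lemma sum_upd_Suc: "(\<Sum>a\<in>UNIV. (\<alpha>(j := Suc (\<alpha> j))) a) = Suc (\<Sum>a\<in>UNIV. \<alpha> a)"
  for \<alpha> :: "'n::finite \<Rightarrow> nat"
proof -
  have "(\<Sum>a\<in>UNIV - {j}. (\<alpha>(j := Suc (\<alpha> j))) a) = (\<Sum>a\<in>UNIV - {j}. \<alpha> a)"
    by (rule sum.cong) auto
  then show ?thesis
    by (simp add: sum.remove[of UNIV j])
qed

lemma cmod_monomial_le: "cmod (monomial \<alpha> z) \<le> norm z ^ (\<Sum>j\<in>UNIV. \<alpha> j)"
proof -
  have "cmod (monomial \<alpha> z) = (\<Prod>j\<in>UNIV. cmod (z $ j) ^ \<alpha> j)"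
    by (simp add: monomial_def norm_power flip: prod_norm)
  also have "\<dots> \<le> (\<Prod>j\<in>UNIV. norm z ^ \<alpha> j)"
    by (rule prod_mono) (simp add: power_mono Finite_Cartesian_Product.norm_nth_le)
  also have "\<dots> = norm z ^ (\<Sum>j\<in>UNIV. \<alpha> j)"
    by (simp add: power_sum)
  finally show ?thesis .
qed

lemma borel_measurable_monomial: "monomial \<alpha> \<in> borel_measurable borel"
  unfolding monomial_def[abs_def]
  by (intro borel_measurable_continuous_onI continuous_intros)

lemma norm_power2_complex_vec: "(norm z)\<^sup>2 = (\<Sum>j\<in>UNIV. (cmod (z $ j))\<^sup>2)"
  for z :: "complex ^ 'n"
  by (simp add: norm_vec_def L2_set_def sum_nonneg)

section \<open>Two families of unitary matrices\<close>

definition phase_matrix :: "'n \<Rightarrow> complex \<Rightarrow> complex ^ 'n ^ 'n" where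
  "phase_matrix j w = (\<chi> a b. if a = b then (if a = j then w else 1) else 0)"

definition rotation_matrix :: "'n \<Rightarrow> 'n \<Rightarrow> real \<Rightarrow> real \<Rightarrow> complex ^ 'n ^ 'n" where
  "rotation_matrix i j c s = (\<chi> a b.
     if a = i then (if b = i then of_real c else if b = j then of_real s else 0)
     else if a = j then (if b = i then - of_real s else if b = j then of_real c else 0)
     else if a = b then 1 else 0)"

lemma phase_matrix_mult: "phase_matrix j w *v z = (\<chi> a. (if a = j then w else 1) * z $ a)"
  by (simp add: phase_matrix_def matrix_vector_mult_def vec_eq_iff if_distrib[of "\<lambda>x. x * _"]
      sum.delta' cong: if_cong)

lemma rotation_matrix_mult:
  assumes "i \<noteq> j"
  shows "rotation_matrix i j c s *v z = (\<chi> a.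
    if a = i then of_real c * z $ i + of_real s * z $ j
    else if a = j then of_real c * z $ j - of_real s * z $ i else z $ a)"
proof -
  have two: "(\<Sum>b\<in>UNIV. (if b = i then x else if b = j then y else 0) * z $ b) = x * z $ i + y * z $ j"
    for x y
  proof -
    have "(\<Sum>b\<in>UNIV. (if b = i then x else if b = j then y else 0) * z $ b)
        = (\<Sum>b\<in>UNIV. (if b = i then x * z $ i else 0) + (if b = j then y * z $ j else 0))"
      using assms by (intro sum.cong) auto
    then show ?thesis
      by (simp add: sum.distrib)
  qed
  have one: "(\<Sum>b\<in>UNIV. (if a = b then 1 else 0) * z $ b) = z $ a" for a
    by (simp add: if_distrib[of "\<lambda>x. x * _"] cong: if_cong)
  show ?thesis
    using assms two one
    by (auto simp: rotation_matrix_def matrix_vector_mult_def vec_eq_iff algebra_simps)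
qed

lemma unitary_phase_matrix:
  assumes "cmod w = 1"
  shows "unitary (phase_matrix j w)"
proof -
  have "w * (cnj w * x) = x" "cnj w * (w * x) = x" for x
    using assms complex_norm_square[of w] by (simp_all add: mult.commute flip: mult.assoc)
  moreover have "conj_transpose (phase_matrix j w) = phase_matrix j (cnj w)"
    by (auto simp: conj_transpose_def phase_matrix_def vec_eq_iff)
  ultimately show ?thesis
    by (simp add: unitary_def matrix_eq phase_matrix_mult vec_eq_iff
        flip: matrix_vector_mul_assoc)
qed

lemma unitary_rotation_matrix:
  assumes "i \<noteq> j" "c\<^sup>2 + s\<^sup>2 = 1"
  shows "unitary (rotation_matrix i j c s)"
proof -
  have transpose: "conj_transpose (rotation_matrix i j c s) = rotation_matrix i j c (- s)"
    using assms(1) by (auto simp: conj_transpose_def rotation_matrix_def vec_eq_iff)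
  have "rotation_matrix i j c s *v (rotation_matrix i j c (- s) *v z) = z"
    if "c\<^sup>2 + s\<^sup>2 = 1" for c s z
  proof -
    have *: "of_real c * of_real c + of_real s * of_real s = (1::complex)"
      using that by (metis of_real_1 of_real_add of_real_mult power2_eq_square)
    have "c * (c * x - s * y) + s * (c * y + s * x) = x"
      "c * (c * y + s * x) - s * (c * x - s * y) = y"
      if "c * c + s * s = 1" for c s x y :: complex
      using that by algebra+
    from this[OF *] show ?thesis
      using assms(1) by (auto simp: rotation_matrix_mult vec_eq_iff)
  qed
  from this[of c s] this[of c "- s"] show ?thesis
    using assms(2) by (simp add: unitary_def transpose matrix_eq flip: matrix_vector_mul_assoc)
qed

section \<open>Norms of monomials for a rotation-invariant measure\<close>

locale rotation_invariant_measure =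
  fixes \<mu> :: "(complex ^ 'n) measure"
  assumes sets_eq: "sets \<mu> = sets borel"
    and invariant: "rotation_invariant \<mu>"
    and integrable_norm_power: "\<And>d. integrable \<mu> (\<lambda>z. norm z ^ (2 * d))"
    and moment_pos: "\<And>d. 0 < moment \<mu> d"
begin

lemma measurable_borelI: "f \<in> borel_measurable borel \<Longrightarrow> f \<in> borel_measurable \<mu>"
  using measurable_cong_sets[OF sets_eq refl] by blast

lemma finite_measure: "finite_measure \<mu>"
proof
  have "integrable \<mu> (\<lambda>z. 1 :: real)"
    using integrable_norm_power[of 0] by simp
  then show "emeasure \<mu> (space \<mu>) \<noteq> \<infinity>"
    by (simp add: integrable_iff_bounded top.not_eq_extremum)
qed

lemma integral_unitary:
  fixes f :: "complex ^ 'n \<Rightarrow> 'b :: {banach, second_countable_topology}"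
  assumes "unitary U" and f: "f \<in> borel_measurable borel"
  shows "(LINT z|\<mu>. f (U *v z)) = (LINT z|\<mu>. f z)"
proof -
  have "(\<lambda>z. U *v z) \<in> borel_measurable borel"
    unfolding matrix_vector_mult_def
    by (intro borel_measurable_continuous_onI continuous_intros)
  then have "(LINT z|\<mu>. f (U *v z)) = (LINT z|distr \<mu> borel (\<lambda>z. U *v z). f z)"
    using f by (intro integral_distr[symmetric] measurable_borelI)
  then show ?thesis
    using assms(1) invariant by (simp add: rotation_invariant_def)
qed

lemma weighted_monomial_integrable:
  "integrable \<mu> (\<lambda>z. norm z ^ (2 * k) * (cmod (monomial \<alpha> z))\<^sup>2)"
proof (rule Bochner_Integration.integrable_bound[OF integrable_norm_power])
  have [measurable]: "monomial \<alpha> \<in> borel_measurable \<mu>" "norm \<in> borel_measurable \<mu>"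
    by (simp_all add: measurable_borelI borel_measurable_monomial)
  show "(\<lambda>z. norm z ^ (2 * k) * (cmod (monomial \<alpha> z))\<^sup>2) \<in> borel_measurable \<mu>"
    by measurable
  have "norm z ^ (2 * k) * (cmod (monomial \<alpha> z))\<^sup>2 \<le> norm z ^ (2 * (k + (\<Sum>j\<in>UNIV. \<alpha> j)))" for z
  proof -
    have "(cmod (monomial \<alpha> z))\<^sup>2 \<le> (norm z ^ (\<Sum>j\<in>UNIV. \<alpha> j))\<^sup>2"
      by (intro power_mono cmod_monomial_le norm_ge_zero)
    then have "norm z ^ (2 * k) * (cmod (monomial \<alpha> z))\<^sup>2
        \<le> norm z ^ (2 * k) * (norm z ^ (\<Sum>j\<in>UNIV. \<alpha> j))\<^sup>2"
      by (rule mult_left_mono) simp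
    also have "\<dots> = norm z ^ (2 * (k + (\<Sum>j\<in>UNIV. \<alpha> j)))"
      by (simp add: power_add distrib_left mult.commute flip: power_mult)
    finally show ?thesis .
  qed
  then show "AE z in \<mu>. norm (norm z ^ (2 * k) * (cmod (monomial \<alpha> z))\<^sup>2)
      \<le> norm (norm z ^ (2 * (k + (\<Sum>j\<in>UNIV. \<alpha> j))))"
    by (intro AE_I2) simp
qed

lemma monomial_L2 [simp]: "monomial \<alpha> \<in> L2 \<mu>"
  using weighted_monomial_integrable[of 0 \<alpha>]
  by (simp add: L2_def measurable_borelI borel_measurable_monomial)

definition sqnorm :: "('n \<Rightarrow> nat) \<Rightarrow> real" where
  "sqnorm \<alpha> = (L2_norm \<mu> (monomial \<alpha>))\<^sup>2"

lemma sqnorm_eq: "sqnorm \<alpha> = (LINT z|\<mu>. (cmod (monomial \<alpha> z))\<^sup>2)"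
  by (simp add: sqnorm_def L2_norm_power2)

text \<open>
  The invariance under multiplication of the single coordinate \<open>z\<^sub>j\<close> by a unimodular number
  \<open>w\<close> multiplies the inner product by \<open>w ^ \<alpha> j * cnj (w ^ \<beta> j)\<close>, which is not \<open>1\<close> for a suitable \<open>w\<close>.
\<close>
lemma monomial_orthogonal:
  assumes "\<alpha> \<noteq> \<beta>"
  shows "L2_inner \<mu> (monomial \<alpha>) (monomial \<beta>) = 0"
proof -
  obtain j where j: "\<alpha> j \<noteq> \<beta> j"
    using assms by auto
  \<comment> \<open>the angle that makes the inner product change its sign\<close>
  define \<theta> where "\<theta> = pi / (real (\<alpha> j) - real (\<beta> j))"
  define w where "w = cis \<theta>"
  have transform: "monomial \<gamma> (phase_matrix j w *v z) = w ^ \<gamma> j * monomial \<gamma> z" for \<gamma> z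
  proof -
    have "(if a = j then w else 1) ^ \<gamma> a = (if a = j then w ^ \<gamma> j else 1)" for a
      by simp
    then show ?thesis
      by (simp add: monomial_def phase_matrix_mult power_mult_distrib prod.distrib)
  qed
  have "w ^ \<alpha> j * cnj (w ^ \<beta> j) = cis (real (\<alpha> j) * \<theta>) * cis (- (real (\<beta> j) * \<theta>))"
    unfolding w_def Complex.DeMoivre cis_cnj ..
  also have "\<dots> = cis ((real (\<alpha> j) - real (\<beta> j)) * \<theta>)"
    by (simp add: cis_mult left_diff_distrib)
  also have "\<dots> = -1"
    using j by (simp add: \<theta>_def)
  finally have phase: "w ^ \<alpha> j * cnj (w ^ \<beta> j) = -1" .
  have "L2_inner \<mu> (monomial \<alpha>) (monomial \<beta>)
      = (LINT z|\<mu>. monomial \<alpha> (phase_matrix j w *v z) * cnj (monomial \<beta> (phase_matrix j w *v z)))"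
    unfolding L2_inner_def
    by (intro integral_unitary[symmetric] unitary_phase_matrix borel_measurable_times
        borel_measurable_cnj borel_measurable_monomial) (simp add: w_def)
  also have "\<dots> = (LINT z|\<mu>. (w ^ \<alpha> j * cnj (w ^ \<beta> j)) * (monomial \<alpha> z * cnj (monomial \<beta> z)))"
    by (simp only: transform complex_cnj_mult mult_ac)
  also have "\<dots> = - L2_inner \<mu> (monomial \<alpha>) (monomial \<beta>)"
    by (simp only: phase L2_inner_def) simp
  finally show ?thesis
    by simp
qed

lemma L2_inner_monomial:
  "L2_inner \<mu> (monomial \<alpha>) (monomial \<beta>) = (if \<alpha> = \<beta> then of_real (sqnorm \<alpha>) else 0)"
  by (simp add: monomial_orthogonal L2_inner_self sqnorm_def)

lemma L2_inner_monomial_combination: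
  assumes "finite A"
  shows "L2_inner \<mu> (\<lambda>z. \<Sum>\<alpha>\<in>A. c \<alpha> * monomial \<alpha> z) (monomial \<beta>)
    = (if \<beta> \<in> A then c \<beta> * of_real (sqnorm \<beta>) else 0)"
  using assms by (simp add: L2_inner_sum_left L2_inner_monomial if_distrib cong: if_cong)

lemma L2_norm_monomial_combination:
  assumes "finite A"
  shows "(L2_norm \<mu> (\<lambda>z. \<Sum>\<alpha>\<in>A. c \<alpha> * monomial \<alpha> z))\<^sup>2 = (\<Sum>\<alpha>\<in>A. (cmod (c \<alpha>))\<^sup>2 * sqnorm \<alpha>)"
proof -
  have "complex_of_real ((L2_norm \<mu> (\<lambda>z. \<Sum>\<alpha>\<in>A. c \<alpha> * monomial \<alpha> z))\<^sup>2)
      = (\<Sum>\<alpha>\<in>A. cnj (c \<alpha>) * (c \<alpha> * of_real (sqnorm \<alpha>)))"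
    unfolding L2_inner_self[symmetric]
    using assms by (simp add: L2_inner_sum_right L2_inner_monomial_combination)
  also have "\<dots> = of_real (\<Sum>\<alpha>\<in>A. (cmod (c \<alpha>))\<^sup>2 * sqnorm \<alpha>)"
    by (simp only: of_real_sum of_real_mult complex_norm_square mult_ac)
  finally show ?thesis
    by (simp only: of_real_eq_iff)
qed

text \<open>
  Rotating the coordinates \<open>i\<close> and \<open>j\<close> shows that the integral of
  \<open>\<bar>x z\<^sub>i + z\<^sub>j\<bar>\<^bsup>2m\<^esup> \<bar>z\<^sup>\<gamma>\<bar>\<^sup>2\<close> is \<open>(x\<^sup>2 + 1)\<^sup>m\<close> times that of
  \<open>\<bar>z\<^sub>i\<bar>\<^bsup>2m\<^esup> \<bar>z\<^sup>\<gamma>\<bar>\<^sup>2\<close>. By the binomial theorem and orthogonality both sides are polynomials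
  in \<open>x\<^sup>2\<close>; the claim compares their coefficients.
\<close>

lemma sqnorm_merge_coordinates:
  assumes "i \<noteq> j"
  shows "real ((\<alpha> i + \<alpha> j) choose \<alpha> i) * sqnorm \<alpha> = sqnorm (\<alpha>(i := \<alpha> i + \<alpha> j, j := 0))"
proof -
  define m where "m = \<alpha> i + \<alpha> j"
  define \<gamma> where "\<gamma> = \<alpha>(i := 0, j := 0)"
  define \<beta> where "\<beta> k = \<gamma>(i := k, j := m - k)" for k
  have \<beta>_monomial: "monomial (\<beta> k) z = (z $ i) ^ k * (z $ j) ^ (m - k) * monomial \<gamma> z" for k z
  proof -
    have "\<gamma>(i := k, j := 0) = \<gamma>(i := k)" "\<gamma>(i := 0) = \<gamma>"
      using assms by (auto simp: \<gamma>_def)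
    then show ?thesis
      using monomial_upd[of "\<gamma>(i := k)" j "m - k" z] monomial_upd[of \<gamma> i k z]
      by (simp add: \<beta>_def mult_ac)
  qed
  have \<beta>_i: "\<beta> k i = k" for k
    using assms by (simp add: \<beta>_def)
  have inj: "inj_on \<beta> {..m}"
    by (rule inj_onI) (metis \<beta>_i)
  have expand: "(\<Sum>k\<le>m. (real (m choose k))\<^sup>2 * sqnorm (\<beta> k) * (x\<^sup>2) ^ k)
      = (x\<^sup>2 + 1) ^ m * sqnorm (\<beta> m)" for x :: real
  proof -
    \<comment> \<open>\<open>U\<close> has the normalized row \<open>(x, 1) / r\<close> in the coordinates \<open>i\<close>, \<open>j\<close>\<close>
    define r where "r = sqrt (x\<^sup>2 + 1)"
    have "0 < x\<^sup>2 + 1"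
      by (simp add: add_nonneg_pos)
    then have "0 < r" "r\<^sup>2 = x\<^sup>2 + 1"
      by (simp_all add: r_def)
    define U where "U = rotation_matrix i j (x / r) (1 / r)"
    have "(x / r)\<^sup>2 + (1 / r)\<^sup>2 = (x\<^sup>2 + 1) / r\<^sup>2"
      by (simp add: power_divide add_divide_distrib)
    also have "\<dots> = 1"
      using \<open>0 < x\<^sup>2 + 1\<close> by (simp add: \<open>r\<^sup>2 = x\<^sup>2 + 1\<close>)
    finally have "(x / r)\<^sup>2 + (1 / r)\<^sup>2 = 1" .
    then have "unitary U"
      unfolding U_def using assms by (intro unitary_rotation_matrix)
    define p where "p z = (of_real x * z $ i + z $ j) ^ m * monomial \<gamma> z" for z :: "complex ^ 'n"
    have "monomial (\<beta> m) (U *v z) = p z / of_real (r ^ m)" for z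
    proof -
      have "monomial \<gamma> (U *v z) = monomial \<gamma> z"
        using assms by (intro monomial_cong) (auto simp: U_def rotation_matrix_mult \<gamma>_def)
      moreover have "(U *v z) $ i = (of_real x * z $ i + z $ j) / of_real r"
        using assms by (simp add: U_def rotation_matrix_mult add_divide_distrib)
      ultimately show ?thesis
        by (simp add: \<beta>_monomial p_def power_divide)
    qed
    moreover have "(\<lambda>z. (cmod (monomial (\<beta> m) z))\<^sup>2) \<in> borel_measurable borel"
      by (intro borel_measurable_power measurable_compose[OF borel_measurable_monomial]) simp
    ultimately have "sqnorm (\<beta> m) = (LINT z|\<mu>. (cmod (p z / of_real (r ^ m)))\<^sup>2)"
      using integral_unitary[OF \<open>unitary U\<close>, of "\<lambda>z. (cmod (monomial (\<beta> m) z))\<^sup>2"]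
      by (simp add: sqnorm_eq)
    also have "\<dots> = (L2_norm \<mu> p)\<^sup>2 / (r\<^sup>2) ^ m"
      using \<open>0 < r\<close> by (simp add: L2_norm_power2 norm_divide power_divide norm_power
          power_mult[symmetric] mult.commute)
    finally have "(x\<^sup>2 + 1) ^ m * sqnorm (\<beta> m) = (L2_norm \<mu> p)\<^sup>2"
      using \<open>0 < r\<close> by (simp add: \<open>r\<^sup>2 = x\<^sup>2 + 1\<close>[symmetric])
    also have "p = (\<lambda>z. \<Sum>k\<le>m. (of_nat (m choose k) * of_real x ^ k) * monomial (\<beta> k) z)"
      by (auto simp: fun_eq_iff p_def binomial_ring \<beta>_monomial sum_distrib_left power_mult_distrib mult_ac)
    \<comment> \<open>index by the multi-indices themselves, so that orthogonality applies\<close>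
    also have "\<dots> = (\<lambda>z. \<Sum>\<beta>'\<in>\<beta> ` {..m}. (of_nat (m choose (\<beta>' i)) * of_real x ^ (\<beta>' i)) * monomial \<beta>' z)"
      using inj by (simp add: sum.reindex \<beta>_i)
    also have "(L2_norm \<mu> \<dots>)\<^sup>2 = (\<Sum>\<beta>'\<in>\<beta> ` {..m}.
        (cmod (of_nat (m choose (\<beta>' i)) * of_real x ^ (\<beta>' i)))\<^sup>2 * sqnorm \<beta>')"
      by (rule L2_norm_monomial_combination) simp
    also have "\<dots> = (\<Sum>k\<le>m. (cmod (of_nat (m choose k) * of_real x ^ k))\<^sup>2 * sqnorm (\<beta> k))"
      using inj by (simp add: sum.reindex \<beta>_i)
    also have "\<dots> = (\<Sum>k\<le>m. (real (m choose k))\<^sup>2 * sqnorm (\<beta> k) * (x\<^sup>2) ^ k)"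
    proof -
      have "(\<bar>x\<bar> ^ k)\<^sup>2 = (x\<^sup>2) ^ k" for k
        using power_mult[of "\<bar>x\<bar>" k 2] power_mult[of "\<bar>x\<bar>" 2 k] by (simp add: mult.commute)
      then show ?thesis
        by (simp add: norm_mult norm_power power_mult_distrib mult_ac)
    qed
    finally show ?thesis ..
  qed
  define d where "d k = (real (m choose k))\<^sup>2 * sqnorm (\<beta> k) - real (m choose k) * sqnorm (\<beta> m)" for k
  have "(\<Sum>k\<le>m. d k * y ^ k) = 0" if "0 \<le> y" for y :: real
  proof -
    have "(\<Sum>k\<le>m. (real (m choose k))\<^sup>2 * sqnorm (\<beta> k) * y ^ k) = (y + 1) ^ m * sqnorm (\<beta> m)"
      using expand[of "sqrt y"] that by simp
    also have "\<dots> = (\<Sum>k\<le>m. real (m choose k) * sqnorm (\<beta> m) * y ^ k)"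
      by (simp add: binomial_ring sum_distrib_left mult_ac)
    finally show ?thesis
      by (simp add: d_def left_diff_distrib sum_subtractf)
  qed
  then have "{0..} \<subseteq> {y. (\<Sum>k\<le>m. d k * y ^ k) = 0}"
    by auto
  then have "infinite {y. (\<Sum>k\<le>m. d k * y ^ k) = 0}"
    using infinite_Ici finite_subset by blast
  then have "d (\<alpha> i) = 0"
    using Transcendental.polyfun_finite_roots[of d m] by (auto simp: m_def)
  moreover have "0 < real (m choose \<alpha> i)"
    by (simp add: m_def zero_less_binomial)
  ultimately have "real (m choose \<alpha> i) * sqnorm (\<beta> (\<alpha> i)) = sqnorm (\<beta> m)"
    by (simp add: d_def power2_eq_square)
  moreover have "\<beta> (\<alpha> i) = \<alpha>" "\<beta> m = \<alpha>(i := m, j := 0)"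
    using assms by (auto simp: \<beta>_def \<gamma>_def m_def)
  ultimately show ?thesis
    by (simp add: m_def)
qed

lemma sqnorm_div_fact_merge:
  assumes "i \<noteq> j"
  shows "sqnorm \<alpha> / (\<Prod>a\<in>UNIV. fact (\<alpha> a)) = sqnorm (\<alpha>(i := \<alpha> i + \<alpha> j, j := 0))
    / (\<Prod>a\<in>UNIV. fact ((\<alpha>(i := \<alpha> i + \<alpha> j, j := 0)) a))"
proof -
  define P where "P = (\<Prod>a\<in>UNIV - {i} - {j}. fact (\<alpha> a) :: real)"
  have split: "(\<Prod>a\<in>UNIV. fact (\<beta> a) :: real) = fact (\<beta> i) * fact (\<beta> j) * P"
    if "\<And>a. a \<noteq> i \<Longrightarrow> a \<noteq> j \<Longrightarrow> \<beta> a = \<alpha> a" for \<beta>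
  proof -
    have "(\<Prod>a\<in>UNIV - {i} - {j}. fact (\<beta> a) :: real) = P"
      unfolding P_def using that by (intro prod.cong) auto
    then show ?thesis
      using assms prod.remove[of UNIV i "\<lambda>a. fact (\<beta> a) :: real"]
        prod.remove[of "UNIV - {i}" j "\<lambda>a. fact (\<beta> a) :: real"] by simp
  qed
  have "P \<noteq> 0"
    by (simp add: P_def)
  have "(\<Prod>a\<in>UNIV. fact (\<alpha> a) :: real) = fact (\<alpha> i) * fact (\<alpha> j) * P"
    by (rule split) simp
  moreover have "(\<Prod>a\<in>UNIV. fact ((\<alpha>(i := \<alpha> i + \<alpha> j, j := 0)) a) :: real)
      = fact (\<alpha> i + \<alpha> j) * P"
    using split[of "\<alpha>(i := \<alpha> i + \<alpha> j, j := 0)"] assms by simp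
  moreover have "sqnorm (\<alpha>(i := \<alpha> i + \<alpha> j, j := 0))
      = fact (\<alpha> i + \<alpha> j) / (fact (\<alpha> i) * fact (\<alpha> j)) * sqnorm \<alpha>"
    using sqnorm_merge_coordinates[OF assms, of \<alpha>] by (simp add: binomial_fact)
  ultimately show ?thesis
    using \<open>P \<noteq> 0\<close> by (simp del: fun_upd_apply)
qed

text \<open>
  Collect the exponents in the coordinate \<open>i\<close>, one other coordinate at a time. Thus the quotient
  on the left depends on the degree of \<open>\<alpha>\<close> alone.
\<close>
lemma sqnorm_div_fact_concentrate:
  "sqnorm \<alpha> / (\<Prod>a\<in>UNIV. fact (\<alpha> a))
    = sqnorm ((\<lambda>_. 0)(i := \<Sum>a\<in>UNIV. \<alpha> a)) / fact (\<Sum>a\<in>UNIV. \<alpha> a)"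
proof (induction "card {j. j \<noteq> i \<and> \<alpha> j \<noteq> 0}" arbitrary: \<alpha>)
  case 0
  then have zero: "\<alpha> j = 0" if "j \<noteq> i" for j
    using that by auto
  have \<alpha>_i: "(\<Sum>a\<in>UNIV. \<alpha> a) = \<alpha> i"
    using zero sum.remove[of UNIV i \<alpha>] by simp
  have "(\<Prod>a\<in>UNIV. fact (\<alpha> a) :: real) = fact (\<alpha> i)"
    using zero prod.remove[of UNIV i "\<lambda>a. fact (\<alpha> a) :: real"] by simp
  moreover have "(\<lambda>_. 0)(i := \<alpha> i) = \<alpha>"
    using zero by auto
  ultimately show ?case
    using \<alpha>_i by simp
next
  case (Suc k)
  then have "{j. j \<noteq> i \<and> \<alpha> j \<noteq> 0} \<noteq> {}"
    by (metis card.empty nat.simps(3))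
  then obtain j where j: "j \<noteq> i" "\<alpha> j \<noteq> 0"
    by blast
  define \<beta> where "\<beta> = \<alpha>(i := \<alpha> i + \<alpha> j, j := 0)"
  have "{a. a \<noteq> i \<and> \<beta> a \<noteq> 0} = {a. a \<noteq> i \<and> \<alpha> a \<noteq> 0} - {j}"
    by (auto simp: \<beta>_def)
  then have "k = card {a. a \<noteq> i \<and> \<beta> a \<noteq> 0}"
    using Suc.hyps(2) j by simp
  moreover have "(\<Sum>a\<in>UNIV. \<beta> a) = (\<Sum>a\<in>UNIV. \<alpha> a)"
  proof -
    have "(\<Sum>a\<in>UNIV - {i} - {j}. \<beta> a) = (\<Sum>a\<in>UNIV - {i} - {j}. \<alpha> a)"
      by (rule sum.cong) (auto simp: \<beta>_def)
    moreover have "(\<Sum>a\<in>UNIV. f a) = f i + (f j + (\<Sum>a\<in>UNIV - {i} - {j}. f a))" for f :: "'n \<Rightarrow> nat"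
      using j sum.remove[of UNIV i f] sum.remove[of "UNIV - {i}" j f] by simp
    ultimately show ?thesis
      using j by (simp add: \<beta>_def)
  qed
  ultimately show ?case
    using Suc.hyps(1)[of \<beta>] sqnorm_div_fact_merge[of i j \<alpha>] j by (simp add: \<beta>_def)
qed

text \<open>
  The coordinate in which the exponents are collected is immaterial, so \<open>undefined\<close> serves as
  an arbitrary one.
\<close>
lemma sqnorm_formula:
  obtains \<kappa> :: "nat \<Rightarrow> real"
  where "\<And>\<alpha>. sqnorm \<alpha> = \<kappa> (\<Sum>a\<in>UNIV. \<alpha> a) * (\<Prod>a\<in>UNIV. fact (\<alpha> a))"
proof
  fix \<alpha> :: "'n \<Rightarrow> nat"
  show "sqnorm \<alpha> = (\<lambda>d. sqnorm ((\<lambda>_. 0)(undefined := d)) / fact d) (\<Sum>a\<in>UNIV. \<alpha> a)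
      * (\<Prod>a\<in>UNIV. fact (\<alpha> a))"
    unfolding sqnorm_div_fact_concentrate[of \<alpha> undefined, symmetric] by simp
qed

lemma sum_sqnorm_shift:
  assumes \<kappa>: "\<And>\<alpha>. sqnorm \<alpha> = \<kappa> (\<Sum>a\<in>UNIV. \<alpha> a) * (\<Prod>a\<in>UNIV. fact (\<alpha> a))"
  shows "(\<Sum>j\<in>UNIV. sqnorm (\<alpha>(j := Suc (\<alpha> j))))
    = \<kappa> (Suc (\<Sum>a\<in>UNIV. \<alpha> a)) * real ((\<Sum>a\<in>UNIV. \<alpha> a) + CARD('n)) * (\<Prod>a\<in>UNIV. fact (\<alpha> a))"
proof -
  have "(\<Prod>a\<in>UNIV. fact ((\<alpha>(j := Suc (\<alpha> j))) a) :: real) = real (Suc (\<alpha> j)) * (\<Prod>a\<in>UNIV. fact (\<alpha> a))" for j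
  proof -
    have "(\<Prod>a\<in>UNIV - {j}. fact ((\<alpha>(j := Suc (\<alpha> j))) a) :: real) = (\<Prod>a\<in>UNIV - {j}. fact (\<alpha> a))"
      by (rule prod.cong) auto
    then show ?thesis
      by (simp add: prod.remove[of UNIV j] mult.assoc del: of_nat_Suc)
  qed
  then have "(\<Sum>j\<in>UNIV. sqnorm (\<alpha>(j := Suc (\<alpha> j))))
      = (\<Sum>j\<in>UNIV. \<kappa> (Suc (\<Sum>a\<in>UNIV. \<alpha> a)) * (\<Prod>a\<in>UNIV. fact (\<alpha> a)) * real (Suc (\<alpha> j)))"
    by (intro sum.cong refl) (simp add: \<kappa>[of "\<alpha>(_ := Suc _)"] sum_upd_Suc mult_ac del: fun_upd_apply)
  also have "\<dots> = \<kappa> (Suc (\<Sum>a\<in>UNIV. \<alpha> a)) * (\<Prod>a\<in>UNIV. fact (\<alpha> a)) * (\<Sum>j\<in>UNIV. real (Suc (\<alpha> j)))"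
    by (simp add: sum_distrib_left)
  also have "(\<Sum>j\<in>UNIV. real (Suc (\<alpha> j))) = real ((\<Sum>a\<in>UNIV. \<alpha> a) + CARD('n))"
    by (simp add: sum.distrib)
  finally show ?thesis
    by (simp only: mult_ac)
qed

text \<open>
  These integrals interpolate between \<open>sqnorm \<alpha>\<close>, for \<open>k = 0\<close>, and the moments, for \<open>\<alpha> = 0\<close>.
\<close>
definition wmoment :: "nat \<Rightarrow> ('n \<Rightarrow> nat) \<Rightarrow> real" where
  "wmoment k \<alpha> = (LINT z|\<mu>. norm z ^ (2 * k) * (cmod (monomial \<alpha> z))\<^sup>2)"

lemma wmoment_Suc: "wmoment (Suc k) \<alpha> = (\<Sum>j\<in>UNIV. wmoment k (\<alpha>(j := Suc (\<alpha> j))))"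
proof -
  have "norm z ^ (2 * Suc k) * (cmod (monomial \<alpha> z))\<^sup>2
      = (\<Sum>j\<in>UNIV. norm z ^ (2 * k) * (cmod (monomial (\<alpha>(j := Suc (\<alpha> j))) z))\<^sup>2)" for z
  proof -
    have "norm z ^ (2 * Suc k) = norm z ^ (2 * k) * (norm z)\<^sup>2"
      by (simp add: power2_eq_square)
    then show ?thesis
      by (simp only: norm_power2_complex_vec monomial_Suc norm_mult power_mult_distrib
          sum_distrib_left sum_distrib_right mult_ac)
  qed
  then show ?thesis
    by (simp only: wmoment_def Bochner_Integration.integral_sum[OF weighted_monomial_integrable])
qed

text \<open>
  By the formula for \<open>sqnorm\<close>, inserting the weight \<open>\<bar>z\<bar>\<^sup>2\<close> multiplies the integral of \<open>\<bar>z\<^sup>\<alpha>\<bar>\<^sup>2\<close>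
  by a factor that depends only on the degree \<open>d\<close>. As \<open>\<bar>z\<bar>\<^bsup>2k\<^esup> \<bar>z\<^sup>\<alpha>\<bar>\<^sup>2\<close> is a combination of
  squared monomials of degree \<open>d\<close>, it has the same factor, and the case \<open>\<alpha> = 0\<close> identifies the
  factor as \<open>moment \<mu> (d + 1) / moment \<mu> d\<close>. The claim is free of division because
  \<open>\<kappa> d \<noteq> 0\<close> is itself deduced from it, by induction on \<open>d\<close> and positivity of the moments.
\<close>
lemma wmoment_ratio:
  assumes \<kappa>: "\<And>\<alpha>. sqnorm \<alpha> = \<kappa> (\<Sum>a\<in>UNIV. \<alpha> a) * (\<Prod>a\<in>UNIV. fact (\<alpha> a))"
    and "k + (\<Sum>a\<in>UNIV. \<alpha> a) = d"
  shows "\<kappa> d * wmoment (Suc k) \<alpha> = \<kappa> (Suc d) * real (d + CARD('n)) * wmoment k \<alpha>"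
  using assms(2)
proof (induction k arbitrary: \<alpha>)
  case 0
  have "wmoment 0 \<beta> = sqnorm \<beta>" for \<beta>
    by (simp add: wmoment_def sqnorm_eq)
  then show ?case
    using 0 sum_sqnorm_shift[OF \<kappa>, of \<alpha>] \<kappa>[of \<alpha>] by (simp add: wmoment_Suc mult_ac)
next
  case (Suc k)
  have "\<kappa> d * wmoment (Suc (Suc k)) \<alpha> = (\<Sum>j\<in>UNIV. \<kappa> d * wmoment (Suc k) (\<alpha>(j := Suc (\<alpha> j))))"
    by (simp add: wmoment_Suc[of "Suc k"] sum_distrib_left)
  also have "\<dots> = (\<Sum>j\<in>UNIV. \<kappa> (Suc d) * real (d + CARD('n)) * wmoment k (\<alpha>(j := Suc (\<alpha> j))))"
    using Suc.prems by (intro sum.cong refl Suc.IH) (simp add: sum_upd_Suc del: fun_upd_apply)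
  also have "\<dots> = \<kappa> (Suc d) * real (d + CARD('n)) * wmoment (Suc k) \<alpha>"
    by (simp add: wmoment_Suc[of k] sum_distrib_left)
  finally show ?case .
qed

lemma sqnorm_pos_and_ratio:
  shows sqnorm_pos: "0 < sqnorm \<alpha>"
    and sqnorm_shift_ratio: "(\<Sum>j\<in>UNIV. sqnorm (\<alpha>(j := Suc (\<alpha> j))) / sqnorm \<alpha>)
      = moment \<mu> (Suc (\<Sum>a\<in>UNIV. \<alpha> a)) / moment \<mu> (\<Sum>a\<in>UNIV. \<alpha> a)"
proof -
  obtain \<kappa> where \<kappa>: "\<And>\<alpha>. sqnorm \<alpha> = \<kappa> (\<Sum>a\<in>UNIV. \<alpha> a) * (\<Prod>a\<in>UNIV. fact (\<alpha> a))"
    using sqnorm_formula by metis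
  have fact_pos: "0 < (\<Prod>a\<in>UNIV. fact (\<alpha> a) :: real)"
    by (intro prod_pos) simp
  define d where "d = (\<Sum>a\<in>UNIV. \<alpha> a)"
  have wmoment_0: "wmoment k (\<lambda>_. 0) = moment \<mu> k" for k
    by (simp add: wmoment_def moment_def monomial_def)
  have ratio: "\<kappa> d * moment \<mu> (Suc d) = \<kappa> (Suc d) * real (d + CARD('n)) * moment \<mu> d" for d
    using wmoment_ratio[OF \<kappa>, of d "\<lambda>_. 0" d] by (simp add: wmoment_0)
  have "\<kappa> d \<noteq> 0" for d
  proof (induction d)
    case 0
    have "sqnorm (\<lambda>_. 0) = moment \<mu> 0"
      by (simp add: sqnorm_eq moment_def monomial_def)
    then show ?case
      using \<kappa>[of "\<lambda>_. 0"] moment_pos[of 0] by auto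
  next
    case (Suc d)
    then show ?case
      using ratio[of d] moment_pos[of "Suc d"] by auto
  qed
  then have "sqnorm \<alpha> \<noteq> 0"
    using fact_pos by (simp add: \<kappa>[of \<alpha>])
  then show "0 < sqnorm \<alpha>"
    by (simp add: sqnorm_def)
  have "(\<Sum>j\<in>UNIV. sqnorm (\<alpha>(j := Suc (\<alpha> j))) / sqnorm \<alpha>) = \<kappa> (Suc d) * real (d + CARD('n)) / \<kappa> d"
    using fact_pos sum_sqnorm_shift[OF \<kappa>, of \<alpha>]
    by (simp add: \<kappa>[of \<alpha>] d_def flip: sum_divide_distrib)
  also have "\<dots> = moment \<mu> (Suc d) / moment \<mu> d"
    using ratio[of d] \<open>\<And>d. \<kappa> d \<noteq> 0\<close> moment_pos[of d] by (simp add: field_simps)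
  finally show "(\<Sum>j\<in>UNIV. sqnorm (\<alpha>(j := Suc (\<alpha> j))) / sqnorm \<alpha>)
      = moment \<mu> (Suc (\<Sum>a\<in>UNIV. \<alpha> a)) / moment \<mu> (\<Sum>a\<in>UNIV. \<alpha> a)"
    by (simp add: d_def)
qed

end

section \<open>Polynomials and their closure\<close>

lemma monomial_in_polynomials: "monomial \<alpha> \<in> polynomials"
  unfolding polynomials_def by (intro CollectI exI[of _ "{\<alpha>}"] exI[of _ "\<lambda>_. 1"]) auto

lemma zero_in_polynomials: "(\<lambda>z. 0) \<in> polynomials"
  unfolding polynomials_def by (intro CollectI exI[of _ "{}"]) auto

lemma polynomials_combination:
  assumes "p \<in> polynomials" "q \<in> polynomials"
  shows "(\<lambda>z. a * p z + b * q z) \<in> polynomials"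
proof -
  obtain A c where A: "finite A" and p: "p = (\<lambda>z. \<Sum>\<alpha>\<in>A. c \<alpha> * monomial \<alpha> z)"
    using assms(1) unfolding polynomials_def by blast
  obtain B d where B: "finite B" and q: "q = (\<lambda>z. \<Sum>\<alpha>\<in>B. d \<alpha> * monomial \<alpha> z)"
    using assms(2) unfolding polynomials_def by blast
  define e where "e \<alpha> = a * (if \<alpha> \<in> A then c \<alpha> else 0) + b * (if \<alpha> \<in> B then d \<alpha> else 0)" for \<alpha>
  have "a * p z + b * q z = (\<Sum>\<alpha>\<in>A \<union> B. e \<alpha> * monomial \<alpha> z)" for z
  proof -
    have "p z = (\<Sum>\<alpha>\<in>A \<union> B. (if \<alpha> \<in> A then c \<alpha> else 0) * monomial \<alpha> z)"
      unfolding p using A B by (intro sum.mono_neutral_cong_left) auto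
    moreover have "q z = (\<Sum>\<alpha>\<in>A \<union> B. (if \<alpha> \<in> B then d \<alpha> else 0) * monomial \<alpha> z)"
      unfolding q using A B by (intro sum.mono_neutral_cong_left) auto
    ultimately show ?thesis
      by (simp only: e_def distrib_right sum.distrib sum_distrib_left mult.assoc)
  qed
  then show ?thesis
    unfolding polynomials_def using A B by blast
qed

lemma polynomials_cmult: "p \<in> polynomials \<Longrightarrow> (\<lambda>z. a * p z) \<in> polynomials"
  using polynomials_combination[of p p a 0] by simp

lemma monomial_form_in_polynomial_forms: "monomial_form \<alpha> j \<in> polynomial_forms"
proof -
  have "monomial_form \<alpha> j k \<in> polynomials" for k
    unfolding monomial_form_def
    by (cases "k = j") (simp_all add: monomial_in_polynomials zero_in_polynomials)
  then show ?thesis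
    by (simp add: polynomial_forms_def)
qed

context rotation_invariant_measure
begin

lemma sqnorm_nonzero [simp]: "sqnorm \<alpha> \<noteq> 0"
  using sqnorm_pos[of \<alpha>] by simp

lemma polynomial_L2: "p \<in> polynomials \<Longrightarrow> p \<in> L2 \<mu>"
  by (auto simp: polynomials_def)

lemma A2_L2: "f \<in> A2 \<mu> \<Longrightarrow> f \<in> L2 \<mu>"
  by (simp add: A2_def)

lemma polynomial_A2:
  assumes "p \<in> polynomials"
  shows "p \<in> A2 \<mu>"
  using assms by (auto simp: A2_def polynomial_L2 intro!: bexI[of _ p])

lemma A2_combination:
  assumes "f \<in> A2 \<mu>" "g \<in> A2 \<mu>"
  shows "(\<lambda>z. a * f z + b * g z) \<in> A2 \<mu>"
proof -
  have fg: "f \<in> L2 \<mu>" "g \<in> L2 \<mu>"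
    using assms by (auto simp: A2_L2)
  have "\<exists>p\<in>polynomials. L2_norm \<mu> (\<lambda>z. a * f z + b * g z - p z) < \<epsilon>" if "0 < \<epsilon>" for \<epsilon>
  proof -
    define \<delta> where "\<delta> = \<epsilon> / (cmod a + cmod b + 1)"
    have pos: "0 < cmod a + cmod b + 1"
      by (simp add: add_nonneg_pos)
    then have "0 < \<delta>"
      using that by (simp add: \<delta>_def)
    obtain p where p: "p \<in> polynomials" "L2_norm \<mu> (\<lambda>z. f z - p z) < \<delta>"
      using assms(1) \<open>0 < \<delta>\<close> by (auto simp: A2_def)
    obtain q where q: "q \<in> polynomials" "L2_norm \<mu> (\<lambda>z. g z - q z) < \<delta>"
      using assms(2) \<open>0 < \<delta>\<close> by (auto simp: A2_def)
    have "L2_norm \<mu> (\<lambda>z. a * f z + b * g z - (a * p z + b * q z))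
        = L2_norm \<mu> (\<lambda>z. a * (f z - p z) + b * (g z - q z))"
      by (simp add: algebra_simps)
    also have "\<dots> \<le> cmod a * L2_norm \<mu> (\<lambda>z. f z - p z) + cmod b * L2_norm \<mu> (\<lambda>z. g z - q z)"
      using L2_norm_triangle[of "\<lambda>z. a * (f z - p z)" \<mu> "\<lambda>z. b * (g z - q z)"] fg p q
      by (simp add: L2_norm_cmult polynomial_L2)
    also have "\<dots> \<le> cmod a * \<delta> + cmod b * \<delta>"
      using p q by (intro add_mono mult_left_mono) auto
    also have "\<dots> < (cmod a + cmod b + 1) * \<delta>"
      using \<open>0 < \<delta>\<close> by (simp add: algebra_simps)
    also have "\<dots> = \<epsilon>"
      using pos by (simp add: \<delta>_def)
    finally show ?thesis
      by (rule bexI[where x = "\<lambda>z. a * p z + b * q z"]) (rule polynomials_combination[OF p(1) q(1)])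
  qed
  then show ?thesis
    using fg by (simp add: A2_def)
qed

text \<open>
  Orthogonality passes from the monomials to their closed span by the Cauchy-Schwarz inequality.
\<close>
lemma orthogonal_A2:
  assumes h: "h \<in> L2 \<mu>" and orth: "\<And>\<beta>. L2_inner \<mu> h (monomial \<beta>) = 0" and g: "g \<in> A2 \<mu>"
  shows "L2_inner \<mu> h g = 0"
proof (rule ccontr)
  assume "L2_inner \<mu> h g \<noteq> 0"
  then have pos: "0 < cmod (L2_inner \<mu> h g)"
    by simp
  define \<epsilon> where "\<epsilon> = cmod (L2_inner \<mu> h g) / (L2_norm \<mu> h + 1)"
  have norm_pos: "0 < L2_norm \<mu> h + 1"
    by (simp add: add_nonneg_pos)
  then have "0 < \<epsilon>"
    using pos by (simp add: \<epsilon>_def)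
  then obtain p where p: "p \<in> polynomials" "L2_norm \<mu> (\<lambda>z. g z - p z) < \<epsilon>"
    using g by (auto simp: A2_def)
  have "L2_inner \<mu> h p = 0"
    using p(1) orth h by (auto simp: polynomials_def L2_inner_sum_right)
  then have "L2_inner \<mu> h g = L2_inner \<mu> h (\<lambda>z. g z - p z)"
    using h g p by (simp add: L2_inner_diff_right A2_L2 polynomial_L2)
  also have "cmod \<dots> \<le> L2_norm \<mu> h * L2_norm \<mu> (\<lambda>z. g z - p z)"
    using h g p by (intro L2_Cauchy_Schwarz) (simp_all add: A2_L2 polynomial_L2)
  also have "\<dots> \<le> L2_norm \<mu> h * \<epsilon>"
    using p by (intro mult_left_mono) auto
  also have "\<dots> < (L2_norm \<mu> h + 1) * \<epsilon>"
    using \<open>0 < \<epsilon>\<close> by simp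
  also have "\<dots> = cmod (L2_inner \<mu> h g)"
    using norm_pos by (simp add: \<epsilon>_def)
  finally show False
    by simp
qed

text \<open>
  The coefficients of a polynomial are its Fourier coefficients with respect to the monomials,
  hence depend linearly on the polynomial as a function.
\<close>

definition coefficient :: "(complex ^ 'n \<Rightarrow> complex) \<Rightarrow> ('n \<Rightarrow> nat) \<Rightarrow> complex" where
  "coefficient p \<alpha> = L2_inner \<mu> p (monomial \<alpha>) / of_real (sqnorm \<alpha>)"

lemma coefficient_combination:
  assumes "p \<in> L2 \<mu>" "q \<in> L2 \<mu>"
  shows "coefficient (\<lambda>z. a * p z + b * q z) \<alpha> = a * coefficient p \<alpha> + b * coefficient q \<alpha>"
  using assms by (simp add: coefficient_def L2_inner_add_left add_divide_distrib)

lemma coefficient_monomial: "coefficient (monomial \<alpha>) \<beta> = (if \<alpha> = \<beta> then 1 else 0)"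
  by (simp add: coefficient_def L2_inner_monomial)

lemma polynomial_expansion:
  assumes "p \<in> polynomials"
  shows "finite {\<alpha>. coefficient p \<alpha> \<noteq> 0}"
    and "finite A \<Longrightarrow> {\<alpha>. coefficient p \<alpha> \<noteq> 0} \<subseteq> A
      \<Longrightarrow> p z = (\<Sum>\<alpha>\<in>A. coefficient p \<alpha> * monomial \<alpha> z)"
proof -
  obtain B c where B: "finite B" and p: "p = (\<lambda>z. \<Sum>\<alpha>\<in>B. c \<alpha> * monomial \<alpha> z)"
    using assms unfolding polynomials_def by blast
  have coeff: "coefficient p \<alpha> = (if \<alpha> \<in> B then c \<alpha> else 0)" for \<alpha>
    using B by (simp add: coefficient_def p L2_inner_monomial_combination)
  then have sub: "{\<alpha>. coefficient p \<alpha> \<noteq> 0} \<subseteq> B"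
    by auto
  then show fin: "finite {\<alpha>. coefficient p \<alpha> \<noteq> 0}"
    using B finite_subset by blast
  have "p z = (\<Sum>\<alpha>\<in>B. coefficient p \<alpha> * monomial \<alpha> z)"
    unfolding p using coeff by (intro sum.cong) (auto simp: p)
  also have "\<dots> = (\<Sum>\<alpha> | coefficient p \<alpha> \<noteq> 0. coefficient p \<alpha> * monomial \<alpha> z)"
    using B sub by (intro sum.mono_neutral_right) auto
  finally have eq: "p z = \<dots>" .
  show "p z = (\<Sum>\<alpha>\<in>A. coefficient p \<alpha> * monomial \<alpha> z)"
    if "finite A" "{\<alpha>. coefficient p \<alpha> \<noteq> 0} \<subseteq> A"
    unfolding eq using that by (intro sum.mono_neutral_left) auto
qed

section \<open>The canonical solution operator on monomial forms\<close>

text \<open>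
  By orthogonality, the projection of \<open>cnj (z $ j) * monomial \<alpha> z\<close> to \<open>A\<^sup>2\<close> is a multiple of the
  monomial with exponent \<open>\<alpha> - e\<^sub>j\<close>, and it is \<open>0\<close> if \<open>\<alpha> j = 0\<close>. In the latter case the
  truncated exponent in \<open>solution\<close> is harmless since the coefficient vanishes.
\<close>
definition projection_coefficient :: "('n \<Rightarrow> nat) \<Rightarrow> 'n \<Rightarrow> real" where
  "projection_coefficient \<alpha> j = (if \<alpha> j = 0 then 0 else sqnorm \<alpha> / sqnorm (\<alpha>(j := \<alpha> j - 1)))"

definition solution :: "('n \<Rightarrow> nat) \<Rightarrow> 'n \<Rightarrow> complex ^ 'n \<Rightarrow> complex" where
  "solution \<alpha> j z = cnj (z $ j) * monomial \<alpha> z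
     - of_real (projection_coefficient \<alpha> j) * monomial (\<alpha>(j := \<alpha> j - 1)) z"

lemma conjugate_monomial_L2: "(\<lambda>z. cnj (z $ j) * monomial \<alpha> z) \<in> L2 \<mu>"
  and conjugate_monomial_norm: "(L2_norm \<mu> (\<lambda>z. cnj (z $ j) * monomial \<alpha> z))\<^sup>2 = sqnorm (\<alpha>(j := Suc (\<alpha> j)))"
proof -
  have *: "cmod (cnj (z $ j) * monomial \<alpha> z) = cmod (monomial (\<alpha>(j := Suc (\<alpha> j))) z)" for z :: "complex ^ 'n"
    by (simp only: monomial_Suc norm_mult complex_mod_cnj)
  have "(\<lambda>z. cnj (z $ j) * monomial \<alpha> z) \<in> borel_measurable \<mu>"
    by (intro measurable_borelI borel_measurable_times borel_measurable_monomial
        borel_measurable_continuous_onI continuous_intros)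
  then show "(\<lambda>z. cnj (z $ j) * monomial \<alpha> z) \<in> L2 \<mu>"
    using monomial_L2[of "\<alpha>(j := Suc (\<alpha> j))"] unfolding L2_def mem_Collect_eq * by blast
  show "(L2_norm \<mu> (\<lambda>z. cnj (z $ j) * monomial \<alpha> z))\<^sup>2 = sqnorm (\<alpha>(j := Suc (\<alpha> j)))"
    unfolding L2_norm_power2 sqnorm_eq * ..
qed

lemma conjugate_monomial_inner:
  "L2_inner \<mu> (\<lambda>z. cnj (z $ j) * monomial \<alpha> z) (monomial \<beta>)
    = (if \<alpha> = \<beta>(j := Suc (\<beta> j)) then of_real (sqnorm \<alpha>) else 0)"
proof -
  have "L2_inner \<mu> (\<lambda>z. cnj (z $ j) * monomial \<alpha> z) (monomial \<beta>)
      = L2_inner \<mu> (monomial \<alpha>) (monomial (\<beta>(j := Suc (\<beta> j))))"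
    by (simp only: L2_inner_def monomial_Suc complex_cnj_mult mult_ac)
  then show ?thesis
    by (simp add: L2_inner_monomial)
qed

lemma solution_L2 [simp]: "solution \<alpha> j \<in> L2 \<mu>"
  unfolding solution_def[abs_def] by (intro L2_diff L2_cmult conjugate_monomial_L2 monomial_L2)

lemma solution_orthogonal_monomial: "L2_inner \<mu> (solution \<alpha> j) (monomial \<beta>) = 0"
proof -
  have "L2_inner \<mu> (solution \<alpha> j) (monomial \<beta>)
      = (if \<alpha> = \<beta>(j := Suc (\<beta> j)) then of_real (sqnorm \<alpha>) else 0)
        - of_real (projection_coefficient \<alpha> j)
          * (if \<alpha>(j := \<alpha> j - 1) = \<beta> then of_real (sqnorm (\<alpha>(j := \<alpha> j - 1))) else 0)"
    unfolding solution_def[abs_def]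
    by (simp add: L2_inner_diff_left conjugate_monomial_L2 conjugate_monomial_inner L2_inner_monomial
        del: fun_upd_apply)
  also have "\<dots> = 0"
  proof (cases "\<alpha> j = 0")
    case True
    then have "\<alpha> \<noteq> \<beta>(j := Suc (\<beta> j))"
      by auto
    then show ?thesis
      using True by (simp add: projection_coefficient_def)
  next
    case False
    then have "\<alpha> = \<beta>(j := Suc (\<beta> j)) \<longleftrightarrow> \<alpha>(j := \<alpha> j - 1) = \<beta>"
      by (auto simp: fun_eq_iff)
    then show ?thesis
      using False by (simp add: projection_coefficient_def)
  qed
  finally show ?thesis .
qed

text \<open>
  \<open>solution \<alpha> j\<close> is orthogonal to the monomial that is subtracted in its definition, so its
  squared norm is its inner product with \<open>cnj (z $ j) * monomial \<alpha> z\<close>.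
\<close>
lemma solution_norm:
  "(L2_norm \<mu> (solution \<alpha> j))\<^sup>2
    = sqnorm (\<alpha>(j := Suc (\<alpha> j))) - projection_coefficient \<alpha> j * sqnorm \<alpha>"
proof -
  let ?f = "\<lambda>z. cnj (z $ j) * monomial \<alpha> z" and ?g = "monomial (\<alpha>(j := \<alpha> j - 1))"
  let ?c = "projection_coefficient \<alpha> j"
  have f_g: "of_real ?c * L2_inner \<mu> ?f ?g = of_real (?c * sqnorm \<alpha>)"
  proof (cases "\<alpha> j = 0")
    case True
    then show ?thesis
      by (simp add: projection_coefficient_def)
  next
    case False
    then have "\<alpha> = (\<alpha>(j := \<alpha> j - 1))(j := Suc ((\<alpha>(j := \<alpha> j - 1)) j))"
      by (simp add: fun_eq_iff)
    then show ?thesis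
      using conjugate_monomial_inner[of j \<alpha> "\<alpha>(j := \<alpha> j - 1)"] by simp
  qed
  have "of_real ((L2_norm \<mu> (solution \<alpha> j))\<^sup>2) = L2_inner \<mu> (solution \<alpha> j) (solution \<alpha> j)"
    by (rule L2_inner_self[symmetric])
  also have "\<dots> = L2_inner \<mu> (solution \<alpha> j) (\<lambda>z. ?f z - of_real ?c * ?g z)"
    by (simp add: solution_def[abs_def])
  also have "\<dots> = L2_inner \<mu> (solution \<alpha> j) ?f"
    by (simp add: L2_inner_diff_right conjugate_monomial_L2 solution_orthogonal_monomial)
  also have "\<dots> = L2_inner \<mu> ?f ?f - of_real ?c * L2_inner \<mu> ?g ?f"
    by (simp add: solution_def[abs_def] L2_inner_diff_left conjugate_monomial_L2)
  also have "of_real ?c * L2_inner \<mu> ?g ?f = cnj (of_real ?c * L2_inner \<mu> ?f ?g)"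
    by (subst L2_inner_commute) simp
  also have "L2_inner \<mu> ?f ?f - \<dots> = of_real (sqnorm (\<alpha>(j := Suc (\<alpha> j))) - ?c * sqnorm \<alpha>)"
    unfolding f_g L2_inner_self conjugate_monomial_norm by simp
  finally show ?thesis
    by (simp only: of_real_eq_iff)
qed

lemma solution_diff_A2: "(\<lambda>z. solution \<alpha> j z - cnj (z $ j) * monomial \<alpha> z) \<in> A2 \<mu>"
proof -
  have "(\<lambda>z. - of_real (projection_coefficient \<alpha> j) * monomial (\<alpha>(j := \<alpha> j - 1)) z) \<in> A2 \<mu>"
    by (intro polynomial_A2 polynomials_cmult monomial_in_polynomials)
  then show ?thesis
    by (simp add: solution_def)
qed

text \<open>
  A polynomial determines its coefficients, so \<open>solution\<close> can be extended linearly along the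
  monomial expansions.
\<close>

lemma canonical_solution_operator_exists: "\<exists>S. is_canonical_solution_operator \<mu> S"
proof -
  define S where "S \<omega> z = (\<Sum>j\<in>UNIV. \<Sum>\<alpha> | coefficient (\<omega> j) \<alpha> \<noteq> 0.
    coefficient (\<omega> j) \<alpha> * solution \<alpha> j z)" for \<omega> :: "'n form01" and z
  have S_eq: "S \<omega> z = (\<Sum>j\<in>UNIV. \<Sum>\<alpha>\<in>A j. coefficient (\<omega> j) \<alpha> * solution \<alpha> j z)"
    if "\<And>j. finite (A j)" "\<And>j. {\<alpha>. coefficient (\<omega> j) \<alpha> \<noteq> 0} \<subseteq> A j" for \<omega> z A
    unfolding S_def using that by (intro sum.cong refl sum.mono_neutral_left) auto
  have "linear_operator_on \<mu> polynomial_forms S"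
    unfolding linear_operator_on_def
  proof (intro conjI ballI allI AE_I2)
    fix \<omega> :: "'n form01"
    show "S \<omega> \<in> L2 \<mu>"
      unfolding S_def[abs_def] by simp
  next
    fix \<omega> \<eta> :: "'n form01" and a b z
    assume "\<omega> \<in> polynomial_forms" "\<eta> \<in> polynomial_forms"
    then have \<omega>: "\<omega> j \<in> polynomials" and \<eta>: "\<eta> j \<in> polynomials" for j
      by (auto simp: polynomial_forms_def)
    define A where "A j = {\<alpha>. coefficient (\<omega> j) \<alpha> \<noteq> 0} \<union> {\<alpha>. coefficient (\<eta> j) \<alpha> \<noteq> 0}" for j
    have A: "finite (A j)" for j
      using \<omega> \<eta> by (simp add: A_def polynomial_expansion(1))
    have comb: "coefficient (\<lambda>w. a * \<omega> j w + b * \<eta> j w) \<alpha>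
        = a * coefficient (\<omega> j) \<alpha> + b * coefficient (\<eta> j) \<alpha>" for j \<alpha>
      using \<omega> \<eta> by (intro coefficient_combination polynomial_L2)
    have "S (\<lambda>j w. a * \<omega> j w + b * \<eta> j w) z = (\<Sum>j\<in>UNIV. \<Sum>\<alpha>\<in>A j.
        coefficient (\<lambda>w. a * \<omega> j w + b * \<eta> j w) \<alpha> * solution \<alpha> j z)"
      using A by (intro S_eq) (auto simp: comb A_def)
    also have "\<dots> = a * S \<omega> z + b * S \<eta> z"
    proof -
      have "S \<omega> z = (\<Sum>j\<in>UNIV. \<Sum>\<alpha>\<in>A j. coefficient (\<omega> j) \<alpha> * solution \<alpha> j z)"
        "S \<eta> z = (\<Sum>j\<in>UNIV. \<Sum>\<alpha>\<in>A j. coefficient (\<eta> j) \<alpha> * solution \<alpha> j z)"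
        using A by (auto intro!: S_eq simp: A_def)
      then show ?thesis
        by (simp only: comb distrib_right sum.distrib sum_distrib_left mult.assoc)
    qed
    finally show "S (\<lambda>j w. a * \<omega> j w + b * \<eta> j w) z = a * S \<omega> z + b * S \<eta> z" .
  qed
  moreover have "S (monomial_form \<alpha> j) = solution \<alpha> j" for \<alpha> j
  proof
    fix z
    have coeff: "coefficient (monomial_form \<alpha> j k) \<beta> = (if k = j \<and> \<beta> = \<alpha> then 1 else 0)" for k \<beta>
    proof (cases "k = j")
      case True
      then have "monomial_form \<alpha> j k = monomial \<alpha>"
        by (simp add: monomial_form_def fun_eq_iff)
      then show ?thesis
        using True by (auto simp: coefficient_monomial)
    next
      case False
      then have "monomial_form \<alpha> j k = (\<lambda>z. 0)"
        by (simp add: monomial_form_def fun_eq_iff)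
      then show ?thesis
        using False by (simp add: coefficient_def L2_inner_def)
    qed
    have "S (monomial_form \<alpha> j) z = (\<Sum>k\<in>UNIV. \<Sum>\<beta>\<in>{\<alpha>}. coefficient (monomial_form \<alpha> j k) \<beta> * solution \<beta> k z)"
      by (rule S_eq) (auto simp: coeff)
    also have "\<dots> = solution \<alpha> j z"
      by (simp add: coeff if_distrib[of "\<lambda>x. x * _"] cong: if_cong)
    finally show "S (monomial_form \<alpha> j) z = solution \<alpha> j z" .
  qed
  ultimately have "is_canonical_solution_operator \<mu> S"
    by (simp add: is_canonical_solution_operator_def solution_diff_A2 orthogonal_A2
        solution_orthogonal_monomial)
  then show ?thesis
    by (rule exI[of _ S])
qed

lemma is_canonical: "is_canonical_solution_operator \<mu> (canonical_solution_operator \<mu>)"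
  unfolding canonical_solution_operator_def
  using canonical_solution_operator_exists by (rule someI_ex)

lemma canonical_solution_linear:
  "linear_operator_on \<mu> polynomial_forms (canonical_solution_operator \<mu>)"
  using is_canonical by (simp add: is_canonical_solution_operator_def)

text \<open>
  Two elements of the same coset of \<open>A\<^sup>2\<close> that are both orthogonal to \<open>A\<^sup>2\<close> agree almost
  everywhere.
\<close>

lemma canonical_solution_monomial_form:
  "AE z in \<mu>. canonical_solution_operator \<mu> (monomial_form \<alpha> j) z = solution \<alpha> j z"
proof -
  let ?S = "canonical_solution_operator \<mu> (monomial_form \<alpha> j)"
  have "monomial_form \<alpha> j \<in> polynomial_forms"
    by (simp add: monomial_form_in_polynomial_forms)
  then have S_L2: "?S \<in> L2 \<mu>"
    using canonical_solution_linear by (simp add: linear_operator_on_def)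
  have S: "(\<lambda>z. ?S z - cnj (z $ j) * monomial \<alpha> z) \<in> A2 \<mu>" "\<And>g. g \<in> A2 \<mu> \<Longrightarrow> L2_inner \<mu> ?S g = 0"
    using is_canonical by (auto simp: is_canonical_solution_operator_def)
  have h: "(\<lambda>z. ?S z - solution \<alpha> j z) \<in> A2 \<mu>" (is "?h \<in> _")
    using A2_combination[OF S(1) solution_diff_A2[of \<alpha> j], of 1 "-1"] by simp
  have "L2_inner \<mu> ?h ?h = L2_inner \<mu> ?S ?h - L2_inner \<mu> (solution \<alpha> j) ?h"
    using S_L2 by (simp add: L2_inner_diff_left)
  also have "\<dots> = 0"
    using S(2)[OF h] orthogonal_A2[OF solution_L2 solution_orthogonal_monomial h] by simp
  finally have "L2_norm \<mu> ?h = 0"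
    by (simp add: L2_inner_self)
  then have "AE z in \<mu>. ?h z = 0"
    using S_L2 by (intro L2_norm_eq_0_AE) simp_all
  then show ?thesis
    by simp
qed

section \<open>The sum of the squared norms over all monomial forms\<close>

text \<open>
  The squared norm of the solution for the normalized monomial form.
\<close>
definition hs_term :: "('n \<Rightarrow> nat) \<Rightarrow> 'n \<Rightarrow> real" where
  "hs_term \<alpha> j = (L2_norm \<mu> (solution \<alpha> j))\<^sup>2 / sqnorm \<alpha>"

lemma hs_term_nonneg: "0 \<le> hs_term \<alpha> j"
  using sqnorm_pos[of \<alpha>] by (simp add: hs_term_def)

lemma hs_term_eq:
  "hs_term \<alpha> j = sqnorm (\<alpha>(j := Suc (\<alpha> j))) / sqnorm \<alpha> - projection_coefficient \<alpha> j"
  using sqnorm_pos[of \<alpha>] by (simp add: hs_term_def solution_norm diff_divide_distrib)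

end

lemma finite_degree_le: "finite {\<alpha> :: 'n::finite \<Rightarrow> nat. (\<Sum>a\<in>UNIV. \<alpha> a) \<le> d}"
proof (rule finite_subset)
  show "{\<alpha> :: 'n \<Rightarrow> nat. (\<Sum>a\<in>UNIV. \<alpha> a) \<le> d}
      \<subseteq> {\<alpha>. \<forall>a. (a \<in> UNIV \<longrightarrow> \<alpha> a \<in> {..d}) \<and> (a \<notin> UNIV \<longrightarrow> \<alpha> a = 0)}"
  proof safe
    fix \<alpha> :: "'n \<Rightarrow> nat" and a assume "(\<Sum>a\<in>UNIV. \<alpha> a) \<le> d"
    then show "\<alpha> a \<le> d"
      using member_le_sum[of a UNIV \<alpha>] by simp
  qed auto
qed (intro finite_set_of_finite_funs, auto)

lemma finite_degree_set: "finite {\<alpha> :: 'n::finite \<Rightarrow> nat. (\<Sum>a\<in>UNIV. \<alpha> a) = d}"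
  by (rule finite_subset[OF _ finite_degree_le[of d]]) auto

text \<open>
  An enumeration of the coordinates turns multi-indices into lists of length \<open>n\<close> with sum \<open>d\<close>.
\<close>
lemma card_degree_set:
  "card {\<alpha> :: 'n::finite \<Rightarrow> nat. (\<Sum>a\<in>UNIV. \<alpha> a) = d} = (CARD('n) + d - 1) choose (CARD('n) - 1)"
proof -
  let ?n = "CARD('n)"
  obtain h where h: "bij_betw h {0..<?n} (UNIV :: 'n set)"
    using ex_bij_betw_nat_finite[of "UNIV :: 'n set"] by auto
  define g where "g = the_inv_into {0..<?n} h"
  have hg: "h (g a) = a" "g a < ?n" and gh: "i < ?n \<Longrightarrow> g (h i) = i" for a i
    using h the_inv_into_into[of h "{0..<?n}" a "{0..<?n}"]
    by (auto simp: g_def bij_betw_def f_the_inv_into_f the_inv_into_f_f)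
  have sum_list: "sum_list (map (\<lambda>i. \<alpha> (h i)) [0..<?n]) = (\<Sum>a\<in>UNIV. \<alpha> a)" for \<alpha> :: "'n \<Rightarrow> nat"
    using sum.reindex_bij_betw[OF h, of \<alpha>] by (simp add: interv_sum_list_conv_sum_set_nat)
  have "bij_betw (\<lambda>\<alpha>. map (\<lambda>i. \<alpha> (h i)) [0..<?n]) {\<alpha> :: 'n \<Rightarrow> nat. (\<Sum>a\<in>UNIV. \<alpha> a) = d}
      {l. length l = ?n \<and> sum_list l = d}"
  proof (rule bij_betw_byWitness[where f' = "\<lambda>l a. l ! g a"])
    have list: "map (\<lambda>i. l ! g (h i)) [0..<?n] = l" if "length l = ?n" for l :: "nat list"
      using that gh by (intro nth_equalityI) auto
    show "\<forall>\<alpha>\<in>{\<alpha>. (\<Sum>a\<in>UNIV. \<alpha> a) = d}. (\<lambda>a. map (\<lambda>i. \<alpha> (h i)) [0..<?n] ! g a) = \<alpha>"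
      using hg by auto
    show "\<forall>l\<in>{l. length l = ?n \<and> sum_list l = d}. map (\<lambda>i. l ! g (h i)) [0..<?n] = l"
      using list by auto
    show "(\<lambda>\<alpha>. map (\<lambda>i. \<alpha> (h i)) [0..<?n]) ` {\<alpha>. (\<Sum>a\<in>UNIV. \<alpha> a) = d}
        \<subseteq> {l. length l = ?n \<and> sum_list l = d}"
      using sum_list by auto
    show "(\<lambda>l a. l ! g a) ` {l. length l = ?n \<and> sum_list l = d} \<subseteq> {\<alpha>. (\<Sum>a\<in>UNIV. \<alpha> a) = d}"
    proof safe
      fix l :: "nat list" assume "length l = ?n"
      then show "(\<Sum>a\<in>UNIV. l ! g a) = sum_list l"
        using sum_list[of "\<lambda>a. l ! g a"] list[of l] by simp
    qed
  qed
  then have "card {\<alpha> :: 'n \<Rightarrow> nat. (\<Sum>a\<in>UNIV. \<alpha> a) = d} = (d + ?n - 1) choose d"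
    by (simp add: bij_betw_same_card card_length_sum_list)
  also have "\<dots> = (d + ?n - 1) choose (d + ?n - 1 - d)"
    by (rule binomial_symmetric) (use zero_less_card_finite[where 'a = 'n] in linarith)
  finally show ?thesis
    by (simp add: add.commute)
qed

context rotation_invariant_measure
begin

text \<open>
  Substitute \<open>\<alpha> = \<beta> + e\<^sub>j\<close>: the terms with \<open>\<alpha> j = 0\<close> vanish, and the others correspond to
  arbitrary \<open>\<beta>\<close> of degree \<open>d\<close>.
\<close>
lemma sum_projection_coefficient:
  "(\<Sum>\<alpha> | (\<Sum>a\<in>UNIV. \<alpha> a) = Suc d. \<Sum>j\<in>UNIV. projection_coefficient \<alpha> j)
    = (\<Sum>\<alpha> | (\<Sum>a\<in>UNIV. \<alpha> a) = d. \<Sum>j\<in>UNIV. sqnorm (\<alpha>(j := Suc (\<alpha> j))) / sqnorm \<alpha>)"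
proof -
  have "(\<Sum>\<alpha> | (\<Sum>a\<in>UNIV. \<alpha> a) = Suc d. projection_coefficient \<alpha> j)
      = (\<Sum>\<alpha> | (\<Sum>a\<in>UNIV. \<alpha> a) = d. sqnorm (\<alpha>(j := Suc (\<alpha> j))) / sqnorm \<alpha>)" for j
  proof -
    have "(\<Sum>\<alpha> | (\<Sum>a\<in>UNIV. \<alpha> a) = Suc d. projection_coefficient \<alpha> j)
        = (\<Sum>\<alpha> | (\<Sum>a\<in>UNIV. \<alpha> a) = Suc d \<and> \<alpha> j \<noteq> 0. projection_coefficient \<alpha> j)"
      by (rule sum.mono_neutral_right) (auto simp: finite_degree_set projection_coefficient_def)
    also have "\<dots> = (\<Sum>\<alpha> | (\<Sum>a\<in>UNIV. \<alpha> a) = d. sqnorm (\<alpha>(j := Suc (\<alpha> j))) / sqnorm \<alpha>)"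
    proof (rule sum.reindex_bij_witness[where i = "\<lambda>\<beta>. \<beta>(j := Suc (\<beta> j))" and j = "\<lambda>\<alpha>. \<alpha>(j := \<alpha> j - 1)"])
      fix \<alpha> :: "'n \<Rightarrow> nat"
      assume "\<alpha> \<in> {\<alpha>. (\<Sum>a\<in>UNIV. \<alpha> a) = Suc d \<and> \<alpha> j \<noteq> 0}"
      then have sum: "(\<Sum>a\<in>UNIV. \<alpha> a) = Suc d" and "\<alpha> j \<noteq> 0"
        by auto
      define \<beta> where "\<beta> = \<alpha>(j := \<alpha> j - 1)"
      have \<alpha>: "\<beta>(j := Suc (\<beta> j)) = \<alpha>"
        using \<open>\<alpha> j \<noteq> 0\<close> by (simp add: \<beta>_def)
      then show "(\<alpha>(j := \<alpha> j - 1))(j := Suc ((\<alpha>(j := \<alpha> j - 1)) j)) = \<alpha>"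
        by (simp add: \<beta>_def)
      have "(\<Sum>a\<in>UNIV. \<beta> a) = d"
        using sum sum_upd_Suc[of \<beta> j] by (simp only: \<alpha>)
      then show "\<alpha>(j := \<alpha> j - 1) \<in> {\<alpha>. (\<Sum>a\<in>UNIV. \<alpha> a) = d}"
        by (simp add: \<beta>_def del: fun_upd_apply)
      show "sqnorm ((\<alpha>(j := \<alpha> j - 1))(j := Suc ((\<alpha>(j := \<alpha> j - 1)) j))) / sqnorm (\<alpha>(j := \<alpha> j - 1))
          = projection_coefficient \<alpha> j"
        using \<alpha> \<open>\<alpha> j \<noteq> 0\<close> by (simp add: \<beta>_def projection_coefficient_def)
    qed (auto simp: sum_upd_Suc simp del: fun_upd_apply, auto)
    finally show ?thesis .
  qed
  then show ?thesis
    by (subst (1 2) sum.swap) simp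
qed

lemma sum_sqnorm_ratio:
  "(\<Sum>\<alpha> | (\<Sum>a\<in>UNIV. \<alpha> a) = d. \<Sum>j\<in>UNIV. sqnorm (\<alpha>(j := Suc (\<alpha> j))) / sqnorm \<alpha>)
    = real ((CARD('n) + d - 1) choose (CARD('n) - 1)) * (moment \<mu> (d + 1) / moment \<mu> d)"
  by (simp add: sqnorm_shift_ratio card_degree_set)

text \<open>
  The sum telescopes: the projection coefficients of degree \<open>d + 1\<close> have the same sum as the
  ratios \<open>sqnorm (\<alpha>(j := Suc (\<alpha> j))) / sqnorm \<alpha>\<close> of degree \<open>d\<close>.
\<close>

lemma sum_hs_term:
  "(\<Sum>d\<le>D. \<Sum>\<alpha> | (\<Sum>a\<in>UNIV. \<alpha> a) = d. \<Sum>j\<in>UNIV. hs_term \<alpha> j)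
    = real ((CARD('n) + D - 1) choose (CARD('n) - 1)) * (moment \<mu> (D + 1) / moment \<mu> D)"
proof (induction D)
  case 0
  have "projection_coefficient \<alpha> j = 0" if "(\<Sum>a\<in>UNIV. \<alpha> a) = 0" for \<alpha> j
    using that by (simp add: projection_coefficient_def)
  then show ?case
    using sum_sqnorm_ratio[of 0] by (simp add: hs_term_eq del: fun_upd_apply sum_eq_0_iff)
next
  case (Suc D)
  have "(\<Sum>\<alpha> | (\<Sum>a\<in>UNIV. \<alpha> a) = Suc D. \<Sum>j\<in>UNIV. hs_term \<alpha> j)
      = real ((CARD('n) + Suc D - 1) choose (CARD('n) - 1)) * (moment \<mu> (Suc D + 1) / moment \<mu> (Suc D))
        - real ((CARD('n) + D - 1) choose (CARD('n) - 1)) * (moment \<mu> (D + 1) / moment \<mu> D)"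
    by (simp only: hs_term_eq sum_subtractf sum_projection_coefficient sum_sqnorm_ratio)
  then show ?case
    using Suc.IH by simp
qed

end

section \<open>Forms with square-integrable coefficients\<close>

lemma norm01_L2_set: "norm01 M \<omega> = L2_set (\<lambda>j. L2_norm M (\<omega> j)) UNIV"
  by (simp add: norm01_def L2_set_def)

lemma norm01_nonneg [simp]: "0 \<le> norm01 M \<omega>"
  by (simp add: norm01_L2_set)

lemma norm01_power2: "(norm01 M \<omega>)\<^sup>2 = (\<Sum>j\<in>UNIV. (L2_norm M (\<omega> j))\<^sup>2)"
  by (simp add: norm01_def sum_nonneg)

lemma norm01_zero [simp]: "norm01 M (\<lambda>j z. 0) = 0"
  by (simp add: norm01_def)

lemma norm01_minus_commute: "norm01 M (\<lambda>j z. \<omega> j z - \<eta> j z) = norm01 M (\<lambda>j z. \<eta> j z - \<omega> j z)"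
  unfolding norm01_def by (subst L2_norm_minus_commute) simp

lemma norm01_cmult: "norm01 M (\<lambda>j z. c * \<omega> j z) = cmod c * norm01 M \<omega>"
  by (simp add: norm01_L2_set L2_norm_cmult L2_set_right_distrib)

lemma norm01_triangle:
  assumes "\<And>j. \<omega> j \<in> L2 M" "\<And>j. \<eta> j \<in> L2 M"
  shows "norm01 M (\<lambda>j z. \<omega> j z + \<eta> j z) \<le> norm01 M \<omega> + norm01 M \<eta>"
proof -
  have "norm01 M (\<lambda>j z. \<omega> j z + \<eta> j z) \<le> L2_set (\<lambda>j. L2_norm M (\<omega> j) + L2_norm M (\<eta> j)) UNIV"
    unfolding norm01_L2_set using assms by (intro L2_set_mono L2_norm_triangle) auto
  also have "\<dots> \<le> norm01 M \<omega> + norm01 M \<eta>"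
    unfolding norm01_L2_set by (rule L2_set_triangle_ineq)
  finally show ?thesis .
qed

lemma inner01_self: "inner01 M \<omega> \<omega> = of_real ((norm01 M \<omega>)\<^sup>2)"
  unfolding inner01_def norm01_power2 L2_inner_self of_real_sum ..

lemma inner01_commute: "inner01 M \<eta> \<omega> = cnj (inner01 M \<omega> \<eta>)"
  unfolding inner01_def cnj_sum by (intro sum.cong refl L2_inner_commute)

lemma inner01_sum_left:
  assumes "\<And>k j. k \<in> K \<Longrightarrow> v k j \<in> L2 M" "\<And>j. \<eta> j \<in> L2 M"
  shows "inner01 M (\<lambda>j z. \<Sum>k\<in>K. c k * v k j z) \<eta> = (\<Sum>k\<in>K. c k * inner01 M (v k) \<eta>)"
proof -
  have "inner01 M (\<lambda>j z. \<Sum>k\<in>K. c k * v k j z) \<eta> = (\<Sum>j\<in>UNIV. \<Sum>k\<in>K. c k * L2_inner M (v k j) (\<eta> j))"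
    unfolding inner01_def using assms by (intro sum.cong refl) (simp add: L2_inner_sum_left)
  also have "\<dots> = (\<Sum>k\<in>K. c k * inner01 M (v k) \<eta>)"
    unfolding inner01_def sum_distrib_left by (rule sum.swap)
  finally show ?thesis .
qed

lemma inner01_diff_left:
  assumes "\<And>j. \<omega> j \<in> L2 M" "\<And>j. \<eta> j \<in> L2 M" "\<And>j. \<zeta> j \<in> L2 M"
  shows "inner01 M (\<lambda>j z. \<omega> j z - \<eta> j z) \<zeta> = inner01 M \<omega> \<zeta> - inner01 M \<eta> \<zeta>"
  using assms by (simp add: inner01_def L2_inner_diff_left sum_subtractf)

text \<open>
  Completing the square; this contains Bessel's inequality, Parseval's identity for finite
  combinations and the best approximation property of the Fourier coefficients.
\<close>

lemma norm01_orthonormal_distance: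
  assumes "finite K" and v: "\<And>k j. k \<in> K \<Longrightarrow> v k j \<in> L2 M" and u: "\<And>j. u j \<in> L2 M"
    and orthonormal: "\<And>k l. k \<in> K \<Longrightarrow> l \<in> K \<Longrightarrow> inner01 M (v k) (v l) = (if k = l then 1 else 0)"
  shows "(norm01 M (\<lambda>j z. u j z - (\<Sum>k\<in>K. c k * v k j z)))\<^sup>2
    = (norm01 M u)\<^sup>2 - (\<Sum>k\<in>K. (cmod (inner01 M u (v k)))\<^sup>2)
      + (\<Sum>k\<in>K. (cmod (c k - inner01 M u (v k)))\<^sup>2)"
proof -
  define w where "w = (\<lambda>j z. \<Sum>k\<in>K. c k * v k j z)"
  define a where "a k = inner01 M u (v k)" for k
  have w: "w j \<in> L2 M" for j
    using v by (simp add: w_def)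
  have w_left: "inner01 M w \<eta> = (\<Sum>k\<in>K. c k * inner01 M (v k) \<eta>)" if "\<And>j. \<eta> j \<in> L2 M" for \<eta>
    unfolding w_def using v that by (rule inner01_sum_left)
  have w_v: "inner01 M w (v k) = c k" if "k \<in> K" for k
  proof -
    have "inner01 M w (v k) = (\<Sum>l\<in>K. c l * (if l = k then 1 else 0))"
      unfolding w_left[OF v[OF that]] using that by (intro sum.cong refl) (simp add: orthonormal)
    then show ?thesis
      using \<open>finite K\<close> that by (simp add: if_distrib[of "\<lambda>x. _ * x"] cong: if_cong)
  qed
  have w_w: "inner01 M w w = (\<Sum>k\<in>K. c k * cnj (c k))"
    unfolding w_left[OF w] by (intro sum.cong refl) (metis inner01_commute w_v)
  have w_u: "inner01 M w u = (\<Sum>k\<in>K. c k * cnj (a k))"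
    unfolding w_left[OF u] a_def by (intro sum.cong refl) (metis inner01_commute)
  have u_w: "inner01 M u w = (\<Sum>k\<in>K. a k * cnj (c k))"
    unfolding inner01_commute[of M u w] w_u cnj_sum by (intro sum.cong refl) simp
  have diff_L2: "(\<lambda>z. u j z - w j z) \<in> L2 M" for j
    using u w by simp
  have right: "inner01 M \<eta> (\<lambda>j z. u j z - w j z) = inner01 M \<eta> u - inner01 M \<eta> w"
    if "\<And>j. \<eta> j \<in> L2 M" for \<eta>
    using that u w by (simp add: inner01_def L2_inner_diff_right sum_subtractf)
  have "complex_of_real ((norm01 M (\<lambda>j z. u j z - w j z))\<^sup>2)
      = inner01 M (\<lambda>j z. u j z - w j z) (\<lambda>j z. u j z - w j z)"
    by (rule inner01_self[symmetric])
  also have "\<dots> = inner01 M u (\<lambda>j z. u j z - w j z) - inner01 M w (\<lambda>j z. u j z - w j z)"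
    using u w diff_L2 by (rule inner01_diff_left)
  also have "\<dots> = inner01 M u u - inner01 M u w - (inner01 M w u - inner01 M w w)"
    using right[OF u] right[OF w] by simp
  also have "\<dots> = of_real ((norm01 M u)\<^sup>2)
      + (\<Sum>k\<in>K. c k * cnj (c k) - a k * cnj (c k) - c k * cnj (a k))"
    unfolding u_w w_u w_w inner01_self[of M u] by (simp add: sum_subtractf)
  also have "(\<Sum>k\<in>K. c k * cnj (c k) - a k * cnj (c k) - c k * cnj (a k))
      = (\<Sum>k\<in>K. of_real ((cmod (c k - a k))\<^sup>2 - (cmod (a k))\<^sup>2))"
    by (intro sum.cong refl) (simp only: of_real_diff complex_norm_square, simp add: algebra_simps)
  finally have "(norm01 M (\<lambda>j z. u j z - w j z))\<^sup>2
      = (norm01 M u)\<^sup>2 + (\<Sum>k\<in>K. (cmod (c k - a k))\<^sup>2 - (cmod (a k))\<^sup>2)"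
    unfolding of_real_sum[symmetric] of_real_add[symmetric] of_real_eq_iff .
  then show ?thesis
    by (simp add: w_def a_def sum_subtractf)
qed

lemma norm01_orthonormal_combination:
  assumes "finite K" and v: "\<And>k j. k \<in> K \<Longrightarrow> v k j \<in> L2 M"
    and orthonormal: "\<And>k l. k \<in> K \<Longrightarrow> l \<in> K \<Longrightarrow> inner01 M (v k) (v l) = (if k = l then 1 else 0)"
  shows "(norm01 M (\<lambda>j z. \<Sum>k\<in>K. c k * v k j z))\<^sup>2 = (\<Sum>k\<in>K. (cmod (c k))\<^sup>2)"
proof -
  have "inner01 M (\<lambda>j z. 0) \<eta> = 0" for \<eta>
    by (simp add: inner01_def L2_inner_def)
  then have "(norm01 M (\<lambda>j z. 0 - (\<Sum>k\<in>K. c k * v k j z)))\<^sup>2 = (\<Sum>k\<in>K. (cmod (c k))\<^sup>2)"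
    using norm01_orthonormal_distance[OF assms(1) v _ orthonormal, of "\<lambda>j z. 0" c] by simp
  then show ?thesis
    using norm01_minus_commute[of M "\<lambda>j z. 0" "\<lambda>j z. \<Sum>k\<in>K. c k * v k j z"] by simp
qed

text \<open>
  Bessel's inequality, with respect to the family \<open>v\<close>, for the vector \<open>\<Sum>e\<in>F. cnj (x e) * e\<close>
  of squared norm \<open>\<Sum>e\<in>F. \<bar>x e\<bar>\<^sup>2\<close>.
\<close>

lemma orthonormal_matrix_contraction:
  assumes "finite K" "finite F"
    and v: "\<And>k j. k \<in> K \<Longrightarrow> v k j \<in> L2 M" and e: "\<And>e j. e \<in> F \<Longrightarrow> e j \<in> L2 M"
    and v_orthonormal: "\<And>k l. k \<in> K \<Longrightarrow> l \<in> K \<Longrightarrow> inner01 M (v k) (v l) = (if k = l then 1 else 0)"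
    and e_orthonormal: "\<And>e e'. e \<in> F \<Longrightarrow> e' \<in> F \<Longrightarrow> inner01 M e e' = (if e = e' then 1 else 0)"
  shows "(\<Sum>k\<in>K. (cmod (\<Sum>e\<in>F. inner01 M (v k) e * x e))\<^sup>2) \<le> (\<Sum>e\<in>F. (cmod (x e))\<^sup>2)"
proof -
  define w where "w = (\<lambda>j z. \<Sum>e\<in>F. cnj (x e) * e j z)"
  have w: "w j \<in> L2 M" for j
    using e by (simp add: w_def)
  have norm_w: "(norm01 M w)\<^sup>2 = (\<Sum>e\<in>F. (cmod (x e))\<^sup>2)"
    using norm01_orthonormal_combination[of F "\<lambda>e. e" M "\<lambda>e. cnj (x e)"] assms
    by (simp add: w_def)
  have "inner01 M w (v k) = cnj (\<Sum>e\<in>F. inner01 M (v k) e * x e)" if "k \<in> K" for k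
  proof -
    have "inner01 M w (v k) = (\<Sum>e\<in>F. cnj (x e) * inner01 M e (v k))"
      unfolding w_def using inner01_sum_left[of F "\<lambda>e. e" M "v k"] e v[OF that] by simp
    also have "\<dots> = (\<Sum>e\<in>F. cnj (inner01 M (v k) e * x e))"
      by (intro sum.cong refl) (subst inner01_commute, simp)
    finally show ?thesis
      by simp
  qed
  then have "(\<Sum>k\<in>K. (cmod (\<Sum>e\<in>F. inner01 M (v k) e * x e))\<^sup>2) = (\<Sum>k\<in>K. (cmod (inner01 M w (v k)))\<^sup>2)"
    by (intro sum.cong refl) (simp del: cnj_sum complex_cnj_mult)
  also have "\<dots> = (norm01 M w)\<^sup>2
      - (norm01 M (\<lambda>j z. w j z - (\<Sum>k\<in>K. inner01 M w (v k) * v k j z)))\<^sup>2"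
    using norm01_orthonormal_distance[OF \<open>finite K\<close> v w v_orthonormal,
        where c = "\<lambda>k. inner01 M w (v k)"]
    by simp
  also have "\<dots> \<le> (norm01 M w)\<^sup>2"
    by simp
  finally show ?thesis
    by (simp only: norm_w)
qed

lemma linear_operator_onD:
  assumes "linear_operator_on M D T" "\<omega> \<in> D" "\<eta> \<in> D"
  shows "AE z in M. T (\<lambda>j w. a * \<omega> j w + b * \<eta> j w) z = a * T \<omega> z + b * T \<eta> z"
  using assms by (simp add: linear_operator_on_def)

lemma linear_operator_on_zero:
  assumes T: "linear_operator_on M D T" and zero: "(\<lambda>j w. 0) \<in> D"
  shows "AE z in M. T (\<lambda>j w. 0) z = 0"
proof -
  show ?thesis
    using linear_operator_onD[OF T zero zero, of 0 0] by simp
qed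

lemma linear_operator_on_sum:
  assumes T: "linear_operator_on M D T"
    and D: "\<And>\<omega> \<eta> a b. \<omega> \<in> D \<Longrightarrow> \<eta> \<in> D \<Longrightarrow> (\<lambda>j w. a * \<omega> j w + b * \<eta> j w) \<in> D"
    and zero: "(\<lambda>j w. 0) \<in> D"
    and "finite K" and v: "\<And>k. k \<in> K \<Longrightarrow> v k \<in> D"
  shows "(\<lambda>j w. \<Sum>k\<in>K. c k * v k j w) \<in> D \<and>
    (AE z in M. T (\<lambda>j w. \<Sum>k\<in>K. c k * v k j w) z = (\<Sum>k\<in>K. c k * T (v k) z))"
  using \<open>finite K\<close> v
proof (induction K)
  case empty
  show ?case
    using zero linear_operator_on_zero[OF T zero] by simp
next
  case (insert k K)
  define p where "p = (\<lambda>j w. \<Sum>k\<in>K. c k * v k j w)"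
  have p: "p \<in> D" "AE z in M. T p z = (\<Sum>k\<in>K. c k * T (v k) z)"
    using insert.IH insert.prems by (auto simp: p_def)
  have eq: "(\<lambda>j w. \<Sum>l\<in>insert k K. c l * v l j w) = (\<lambda>j w. c k * v k j w + 1 * p j w)"
    using insert.hyps by (simp add: p_def)
  have "AE z in M. T (\<lambda>j w. c k * v k j w + 1 * p j w) z = c k * T (v k) z + 1 * T p z"
    using insert.prems[of k] by (intro linear_operator_onD[OF T] p(1)) simp
  then have "AE z in M. T (\<lambda>j w. \<Sum>l\<in>insert k K. c l * v l j w) z = (\<Sum>l\<in>insert k K. c l * T (v l) z)"
    using p(2) unfolding eq by eventually_elim (simp add: insert.hyps)
  moreover have "(\<lambda>j w. \<Sum>l\<in>insert k K. c l * v l j w) \<in> D"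
    unfolding eq using insert.prems[of k] p(1) by (intro D) auto
  ultimately show ?case
    by (rule conjI[rotated])
qed

lemma polynomial_forms_combination:
  "\<omega> \<in> polynomial_forms \<Longrightarrow> \<eta> \<in> polynomial_forms \<Longrightarrow> (\<lambda>j w. a * \<omega> j w + b * \<eta> j w) \<in> polynomial_forms"
  by (simp add: polynomial_forms_def polynomials_combination)

lemma zero_in_polynomial_forms: "(\<lambda>j w. 0) \<in> polynomial_forms"
  by (simp add: polynomial_forms_def zero_in_polynomials)

context rotation_invariant_measure
begin

lemma A2_01_L2: "\<omega> \<in> A2_01 \<mu> \<Longrightarrow> \<omega> j \<in> L2 \<mu>"
  by (simp add: A2_01_def A2_L2)

lemma polynomial_form_A2_01: "p \<in> polynomial_forms \<Longrightarrow> p \<in> A2_01 \<mu>"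
  by (simp add: A2_01_def polynomial_forms_def polynomial_A2)

lemma A2_01_combination:
  "\<omega> \<in> A2_01 \<mu> \<Longrightarrow> \<eta> \<in> A2_01 \<mu> \<Longrightarrow> (\<lambda>j w. a * \<omega> j w + b * \<eta> j w) \<in> A2_01 \<mu>"
  by (simp add: A2_01_def A2_combination)

lemma zero_in_A2_01: "(\<lambda>j w. 0) \<in> A2_01 \<mu>"
  by (simp add: polynomial_form_A2_01 zero_in_polynomial_forms)

section \<open>Hilbert-Schmidt sums do not depend on the orthonormal family\<close>

text \<open>
  Expanding \<open>v k\<close> in the basis \<open>E\<close> gives \<open>T (v k) = \<Sum>e\<in>E. inner01 \<mu> (v k) e * T e\<close>. At each
  point \<open>z\<close> the matrix contraction bounds the sum over \<open>k\<close> of the squares by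
  \<open>\<Sum>e\<in>E. \<bar>T e z\<bar>\<^sup>2\<close>, and integration over \<open>z\<close> gives the claim. As the expansion is only
  approximate for finite subfamilies of \<open>E\<close>, boundedness of \<open>T\<close> is used to pass to the limit.
\<close>

lemma hilbert_schmidt_sum_le:
  assumes T: "linear_operator_on \<mu> (A2_01 \<mu>) T"
    and bounded: "\<And>\<omega>. \<omega> \<in> A2_01 \<mu> \<Longrightarrow> L2_norm \<mu> (T \<omega>) \<le> C * norm01 \<mu> \<omega>" and "0 \<le> C"
    and E: "orthonormal_basis_A2_01 \<mu> E" and summable: "(\<lambda>e. (L2_norm \<mu> (T e))\<^sup>2) summable_on E"
    and "finite K" and v: "\<And>k. k \<in> K \<Longrightarrow> v k \<in> A2_01 \<mu>"
    and v_orthonormal: "\<And>k l. k \<in> K \<Longrightarrow> l \<in> K \<Longrightarrow> inner01 \<mu> (v k) (v l) = (if k = l then 1 else 0)"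
  shows "(\<Sum>k\<in>K. (L2_norm \<mu> (T (v k)))\<^sup>2) \<le> (\<Sum>\<^sub>\<infinity>e\<in>E. (L2_norm \<mu> (T e))\<^sup>2)"
proof -
  let ?B = "\<Sum>\<^sub>\<infinity>e\<in>E. (L2_norm \<mu> (T e))\<^sup>2"
  have E_A2: "e \<in> A2_01 \<mu>" if "e \<in> E" for e
    using E that by (auto simp: orthonormal_basis_A2_01_def)
  have E_orthonormal: "inner01 \<mu> e e' = (if e = e' then 1 else 0)" if "e \<in> E" "e' \<in> E" for e e'
    using E that by (auto simp: orthonormal_basis_A2_01_def)
  have T_L2: "T \<omega> \<in> L2 \<mu>" if "\<omega> \<in> A2_01 \<mu>" for \<omega>
    using T that by (simp add: linear_operator_on_def)
  have approx: "(\<Sum>k\<in>K. (max 0 (L2_norm \<mu> (T (v k)) - C * \<epsilon>))\<^sup>2) \<le> ?B" if "0 < \<epsilon>" for \<epsilon>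
  proof -
    define approximates where "approximates k F c \<longleftrightarrow> finite F \<and> F \<subseteq> E \<and>
      norm01 \<mu> (\<lambda>j z. v k j z - (\<Sum>e\<in>F. c e * e j z)) < \<epsilon>" for k F c
    have "\<exists>F c. approximates k F c" if "k \<in> K" for k
      using E v[OF that] \<open>0 < \<epsilon>\<close> unfolding orthonormal_basis_A2_01_def approximates_def by blast
    then obtain F c where "\<And>k. k \<in> K \<Longrightarrow> approximates k (F k) (c k)"
      by metis
    then have F: "\<And>k. k \<in> K \<Longrightarrow> finite (F k)" "\<And>k. k \<in> K \<Longrightarrow> F k \<subseteq> E"
      and c: "\<And>k. k \<in> K \<Longrightarrow> norm01 \<mu> (\<lambda>j z. v k j z - (\<Sum>e\<in>F k. c k e * e j z)) < \<epsilon>"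
      by (simp_all add: approximates_def)
    define G where "G = (\<Union>k\<in>K. F k)"
    have G: "finite G" "G \<subseteq> E"
      unfolding G_def using \<open>finite K\<close> F by (blast intro: finite_UN_I)+
    have G_A2: "e \<in> A2_01 \<mu>" if "e \<in> G" for e
      using E_A2 G that by auto
    have G_orthonormal: "inner01 \<mu> e e' = (if e = e' then 1 else 0)" if "e \<in> G" "e' \<in> G" for e e'
      using that G by (intro E_orthonormal) auto
    define w where "w k = (\<lambda>j z. \<Sum>e\<in>G. inner01 \<mu> (v k) e * e j z)" for k
    define a where "a k = L2_norm \<mu> (\<lambda>z. \<Sum>e\<in>G. inner01 \<mu> (v k) e * T e z)" for k
    have "w k \<in> A2_01 \<mu> \<and> (AE z in \<mu>. T (w k) z = (\<Sum>e\<in>G. inner01 \<mu> (v k) e * T e z))" for k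
      unfolding w_def using T A2_01_combination zero_in_A2_01 G(1) G_A2
      by (rule linear_operator_on_sum[where v = "\<lambda>e. e"])
    then have w: "w k \<in> A2_01 \<mu>" "AE z in \<mu>. T (w k) z = (\<Sum>e\<in>G. inner01 \<mu> (v k) e * T e z)" for k
      by blast+
    have sum_L2: "(\<lambda>z. \<Sum>e\<in>G. inner01 \<mu> (v k) e * T e z) \<in> L2 \<mu>" for k
      using T_L2[OF G_A2] by simp
    \<comment> \<open>the Fourier coefficients are at least as good as the coefficients \<open>c k\<close>\<close>
    have close: "norm01 \<mu> (\<lambda>j z. v k j z - w k j z) \<le> \<epsilon>" if k: "k \<in> K" for k
    proof -
      define d where "d e = (if e \<in> F k then c k e else 0)" for e
      have "(\<Sum>e\<in>F k. c k e * e j z) = (\<Sum>e\<in>G. d e * e j z)" for j z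
        using k G(1) by (intro sum.mono_neutral_cong_left) (auto simp: d_def G_def)
      then have less: "norm01 \<mu> (\<lambda>j z. v k j z - (\<Sum>e\<in>G. d e * e j z)) < \<epsilon>"
        using c[OF k] by simp
      note distance = norm01_orthonormal_distance[of G "\<lambda>e. e" \<mu> "v k"]
      have "(norm01 \<mu> (\<lambda>j z. v k j z - w k j z))\<^sup>2
          \<le> (norm01 \<mu> (\<lambda>j z. v k j z - (\<Sum>e\<in>G. d e * e j z)))\<^sup>2"
        using distance[of "inner01 \<mu> (v k)"] distance[of d] G(1) G_A2 G_orthonormal v[OF k]
        by (simp add: w_def A2_01_L2 sum_nonneg)
      then show ?thesis
        using less by (meson less_imp_le norm01_nonneg order_trans power2_le_imp_le)
    qed
    have T_le: "L2_norm \<mu> (T (v k)) \<le> a k + C * \<epsilon>" if k: "k \<in> K" for k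
    proof -
      define h where "h = (\<lambda>j z. 1 * v k j z + (- 1) * w k j z)"
      have h: "h \<in> A2_01 \<mu>"
        unfolding h_def by (intro A2_01_combination v[OF k] w)
      have "AE z in \<mu>. T h z = 1 * T (v k) z + (- 1) * T (w k) z"
        unfolding h_def by (intro linear_operator_onD[OF T] v[OF k] w)
      then have "AE z in \<mu>. T (v k) z = T h z + (\<Sum>e\<in>G. inner01 \<mu> (v k) e * T e z)"
        using w(2)[of k] by eventually_elim simp
      then have "L2_norm \<mu> (T (v k)) = L2_norm \<mu> (\<lambda>z. T h z + (\<Sum>e\<in>G. inner01 \<mu> (v k) e * T e z))"
        using T_L2[OF v[OF k]] T_L2[OF h] sum_L2 by (intro L2_norm_cong_AE L2_add)
      also have "\<dots> \<le> L2_norm \<mu> (T h) + a k"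
        unfolding a_def using T_L2[OF h] sum_L2 by (intro L2_norm_triangle)
      also have "L2_norm \<mu> (T h) \<le> C * \<epsilon>"
        using bounded[OF h] close[OF k] \<open>0 \<le> C\<close> by (simp add: h_def) (meson mult_left_mono order_trans)
      finally show ?thesis
        by simp
    qed
    have "(\<Sum>k\<in>K. (max 0 (L2_norm \<mu> (T (v k)) - C * \<epsilon>))\<^sup>2) \<le> (\<Sum>k\<in>K. (a k)\<^sup>2)"
      using T_le by (intro sum_mono power_mono) (auto simp: a_def max_def algebra_simps)
    also have "\<dots> = (LINT z|\<mu>. (\<Sum>k\<in>K. (cmod (\<Sum>e\<in>G. inner01 \<mu> (v k) e * T e z))\<^sup>2))"
      using L2_integrable_square[OF sum_L2] by (simp add: a_def L2_norm_power2)
    also have "\<dots> \<le> (LINT z|\<mu>. (\<Sum>e\<in>G. (cmod (T e z))\<^sup>2))"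
    proof (rule integral_mono)
      show "integrable \<mu> (\<lambda>z. \<Sum>k\<in>K. (cmod (\<Sum>e\<in>G. inner01 \<mu> (v k) e * T e z))\<^sup>2)"
        using L2_integrable_square[OF sum_L2] by (intro Bochner_Integration.integrable_sum)
      show "integrable \<mu> (\<lambda>z. \<Sum>e\<in>G. (cmod (T e z))\<^sup>2)"
        by (intro Bochner_Integration.integrable_sum L2_integrable_square T_L2 G_A2)
      show "(\<Sum>k\<in>K. (cmod (\<Sum>e\<in>G. inner01 \<mu> (v k) e * T e z))\<^sup>2) \<le> (\<Sum>e\<in>G. (cmod (T e z))\<^sup>2)" for z
        using \<open>finite K\<close> G(1) A2_01_L2[OF v] A2_01_L2[OF G_A2] v_orthonormal G_orthonormal
        by (rule orthonormal_matrix_contraction)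
    qed
    also have "\<dots> = (\<Sum>e\<in>G. (L2_norm \<mu> (T e))\<^sup>2)"
      using L2_integrable_square[OF T_L2[OF G_A2]] by (simp add: L2_norm_power2)
    also have "\<dots> \<le> ?B"
      using summable G by (intro finite_sum_le_infsum) auto
    finally show ?thesis .
  qed
  have "(\<lambda>n. \<Sum>k\<in>K. (max 0 (L2_norm \<mu> (T (v k)) - C * (1 / real (Suc n))))\<^sup>2)
      \<longlonglongrightarrow> (\<Sum>k\<in>K. (max 0 (L2_norm \<mu> (T (v k)) - C * 0))\<^sup>2)"
    by (intro tendsto_intros LIMSEQ_Suc[OF lim_1_over_n])
  moreover have "\<forall>n\<ge>0. (\<Sum>k\<in>K. (max 0 (L2_norm \<mu> (T (v k)) - C * (1 / real (Suc n))))\<^sup>2) \<le> ?B"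
    by (intro allI impI approx) simp
  ultimately have "(\<Sum>k\<in>K. (max 0 (L2_norm \<mu> (T (v k)) - C * 0))\<^sup>2) \<le> ?B"
    by (intro LIMSEQ_le_const2 exI)
  then show ?thesis
    by (simp add: max_def)
qed

section \<open>The orthonormal basis of normalized monomial forms\<close>

definition normalized_form :: "('n \<Rightarrow> nat) \<times> 'n \<Rightarrow> 'n form01" where
  "normalized_form x = (\<lambda>k z. of_real (inverse (sqrt (sqnorm (fst x)))) * monomial_form (fst x) (snd x) k z)"

lemma normalized_form_in_polynomial_forms: "normalized_form x \<in> polynomial_forms"
  unfolding polynomial_forms_def normalized_form_def
  using monomial_form_in_polynomial_forms[of "fst x" "snd x"]
  by (auto simp: polynomial_forms_def intro: polynomials_cmult)

lemma normalized_form_A2_01: "normalized_form x \<in> A2_01 \<mu>"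
  by (intro polynomial_form_A2_01 normalized_form_in_polynomial_forms)

lemma monomial_form_component: "monomial_form \<alpha> j k = (if k = j then monomial \<alpha> else (\<lambda>z. 0))"
  by (simp add: monomial_form_def fun_eq_iff)

lemma inner01_monomial_form:
  "inner01 \<mu> (monomial_form \<alpha> j) (monomial_form \<beta> k) = (if \<alpha> = \<beta> \<and> j = k then of_real (sqnorm \<alpha>) else 0)"
proof -
  have "L2_inner \<mu> (monomial_form \<alpha> j l) (monomial_form \<beta> k l)
      = (if l = j then (if \<alpha> = \<beta> \<and> j = k then of_real (sqnorm \<alpha>) else 0) else 0)" for l
    by (auto simp: monomial_form_component L2_inner_monomial L2_inner_def[of \<mu> "\<lambda>z. 0"]
        L2_inner_def[of \<mu> _ "\<lambda>z. 0"])
  then show ?thesis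
    by (simp add: inner01_def)
qed

lemma normalized_form_orthonormal:
  "inner01 \<mu> (normalized_form x) (normalized_form y) = (if x = y then 1 else 0)"
proof -
  have "inner01 \<mu> (normalized_form x) (normalized_form y)
      = of_real (inverse (sqrt (sqnorm (fst x))) * inverse (sqrt (sqnorm (fst y))))
        * inner01 \<mu> (monomial_form (fst x) (snd x)) (monomial_form (fst y) (snd y))"
    unfolding inner01_def normalized_form_def sum_distrib_left
    by (intro sum.cong refl) simp
  moreover have "inverse (sqrt (sqnorm \<alpha>)) * inverse (sqrt (sqnorm \<alpha>)) * sqnorm \<alpha> = 1" for \<alpha>
    using sqnorm_pos[of \<alpha>] by (simp flip: inverse_mult_distrib)
  ultimately show ?thesis
    by (auto simp: inner01_monomial_form prod_eq_iff simp flip: of_real_mult)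
qed

lemma inj_normalized_form: "inj normalized_form"
  by (rule injI) (metis normalized_form_orthonormal zero_neq_one)

text \<open>
  On monomial forms an extension agrees almost everywhere with \<open>solution\<close>, and the normalization
  divides the squared norm by \<open>sqnorm\<close>.
\<close>

lemma extension_norm_normalized_form:
  assumes T: "\<And>\<omega>. \<omega> \<in> A2_01 \<mu> \<Longrightarrow> T \<omega> \<in> L2 \<mu>"
    and extends: "\<forall>\<omega>\<in>polynomial_forms. AE z in \<mu>. T \<omega> z = canonical_solution_operator \<mu> \<omega> z"
  shows "(L2_norm \<mu> (T (normalized_form x)))\<^sup>2 = hs_term (fst x) (snd x)"
proof -
  define m where "m = monomial_form (fst x) (snd x)"
  define c where "c = complex_of_real (inverse (sqrt (sqnorm (fst x))))"
  have S_scaled: "AE z in \<mu>. canonical_solution_operator \<mu> (\<lambda>k z. c * m k z + 0 * m k z) z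
      = c * canonical_solution_operator \<mu> m z + 0 * canonical_solution_operator \<mu> m z"
    unfolding m_def by (intro linear_operator_onD[OF canonical_solution_linear]
        monomial_form_in_polynomial_forms)
  have eq: "(\<lambda>k z. c * m k z + 0 * m k z) = normalized_form x"
    by (simp add: normalized_form_def c_def m_def)
  have "AE z in \<mu>. T (normalized_form x) z = canonical_solution_operator \<mu> (normalized_form x) z"
    using extends normalized_form_in_polynomial_forms by blast
  moreover have "AE z in \<mu>. canonical_solution_operator \<mu> m z = solution (fst x) (snd x) z"
    unfolding m_def by (rule canonical_solution_monomial_form)
  ultimately have "AE z in \<mu>. T (normalized_form x) z = c * solution (fst x) (snd x) z"
    using S_scaled unfolding eq by eventually_elim simp
  then have "L2_norm \<mu> (T (normalized_form x)) = L2_norm \<mu> (\<lambda>z. c * solution (fst x) (snd x) z)"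
    by (intro L2_norm_cong_AE T normalized_form_A2_01 L2_cmult solution_L2)
  also have "\<dots> = L2_norm \<mu> (solution (fst x) (snd x)) / sqrt (sqnorm (fst x))"
    using sqnorm_pos[of "fst x"] by (simp add: L2_norm_cmult c_def norm_inverse divide_inverse mult.commute)
  finally show ?thesis
    using sqnorm_pos[of "fst x"] by (simp add: hs_term_def power_divide)
qed

lemma polynomial_form_expansion:
  assumes "p \<in> polynomial_forms"
  obtains A where "finite A"
    "\<And>j z. p j z = (\<Sum>\<alpha>\<in>A. coefficient (p j) \<alpha> * monomial \<alpha> z)"
    "\<And>j z. p j z = (\<Sum>x\<in>A \<times> UNIV. coefficient (p (snd x)) (fst x) * monomial_form (fst x) (snd x) j z)"
proof -
  have p: "p j \<in> polynomials" for j
    using assms by (simp add: polynomial_forms_def)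
  define A where "A = (\<Union>j. {\<alpha>. coefficient (p j) \<alpha> \<noteq> 0})"
  have "finite A"
    by (simp add: A_def polynomial_expansion(1)[OF p])
  moreover have expand: "p j z = (\<Sum>\<alpha>\<in>A. coefficient (p j) \<alpha> * monomial \<alpha> z)" for j z
    using \<open>finite A\<close> by (intro polynomial_expansion(2)[OF p]) (auto simp: A_def)
  moreover have "p j z = (\<Sum>x\<in>A \<times> UNIV. coefficient (p (snd x)) (fst x) * monomial_form (fst x) (snd x) j z)" for j z
  proof -
    have "(\<Sum>k\<in>UNIV. coefficient (p k) \<alpha> * monomial_form \<alpha> k j z) = coefficient (p j) \<alpha> * monomial \<alpha> z" for \<alpha>
      by (simp add: monomial_form_def if_distrib[of "\<lambda>x. _ * x"] cong: if_cong)
    then show ?thesis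
      unfolding sum.cartesian_product' fst_conv snd_conv by (simp only: expand[symmetric])
  qed
  ultimately show ?thesis
    by (rule that)
qed

lemma polynomial_forms_dense:
  assumes "\<omega> \<in> A2_01 \<mu>" "0 < \<epsilon>"
  obtains p where "p \<in> polynomial_forms" "norm01 \<mu> (\<lambda>j z. \<omega> j z - p j z) < \<epsilon>"
proof -
  have "\<exists>q\<in>polynomials. L2_norm \<mu> (\<lambda>z. \<omega> j z - q z) < \<epsilon> / CARD('n)" for j
    using assms by (simp add: A2_01_def A2_def)
  then obtain p where p: "\<And>j. p j \<in> polynomials" "\<And>j. L2_norm \<mu> (\<lambda>z. \<omega> j z - p j z) < \<epsilon> / CARD('n)"
    by metis
  have "norm01 \<mu> (\<lambda>j z. \<omega> j z - p j z) \<le> (\<Sum>j\<in>UNIV. L2_norm \<mu> (\<lambda>z. \<omega> j z - p j z))"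
    unfolding norm01_L2_set by (rule L2_set_le_sum) simp
  also have "\<dots> < (\<Sum>j\<in>(UNIV :: 'n set). \<epsilon> / CARD('n))"
    using p(2) by (intro sum_strict_mono) auto
  also have "\<dots> = \<epsilon>"
    by simp
  finally show ?thesis
    using p(1) by (intro that[of p]) (simp_all add: polynomial_forms_def)
qed

lemma orthonormal_basis_normalized_form: "orthonormal_basis_A2_01 \<mu> (range normalized_form)"
  unfolding orthonormal_basis_A2_01_def
proof (intro conjI ballI allI impI)
  show "range normalized_form \<subseteq> A2_01 \<mu>"
    using normalized_form_A2_01 by auto
  show "inner01 \<mu> e e' = (if e = e' then 1 else 0)"
    if "e \<in> range normalized_form" "e' \<in> range normalized_form" for e e'
    using that by (auto simp: normalized_form_orthonormal inj_eq[OF inj_normalized_form])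
  fix \<omega> and \<epsilon> :: real assume "\<omega> \<in> A2_01 \<mu>" "0 < \<epsilon>"
  then obtain p where p: "p \<in> polynomial_forms" "norm01 \<mu> (\<lambda>j z. \<omega> j z - p j z) < \<epsilon>"
    by (rule polynomial_forms_dense)
  obtain A where A: "finite A"
    "\<And>j z. p j z = (\<Sum>\<alpha>\<in>A. coefficient (p j) \<alpha> * monomial \<alpha> z)"
    "\<And>j z. p j z = (\<Sum>x\<in>A \<times> UNIV. coefficient (p (snd x)) (fst x) * monomial_form (fst x) (snd x) j z)"
    by (rule polynomial_form_expansion[OF p(1)]) (rule that)
  define c where "c x = coefficient (p (snd x)) (fst x) * of_real (sqrt (sqnorm (fst x)))" for x
  define F where "F = normalized_form ` (A \<times> UNIV)"
  have "p j z = (\<Sum>e\<in>F. c (inv normalized_form e) * e j z)" for j z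
  proof -
    have "p j z = (\<Sum>x\<in>A \<times> UNIV. c x * normalized_form x j z)"
      by (subst A(3)) (intro sum.cong refl, simp add: c_def normalized_form_def)
    then show ?thesis
      unfolding F_def using inj_normalized_form
      by (simp add: sum.reindex inj_on_subset[OF inj_normalized_form])
  qed
  then have "finite F \<and> F \<subseteq> range normalized_form \<and>
      norm01 \<mu> (\<lambda>j z. \<omega> j z - (\<Sum>e\<in>F. c (inv normalized_form e) * e j z)) < \<epsilon>"
    using p(2) A(1) by (auto simp: F_def)
  then show "\<exists>F c. finite F \<and> F \<subseteq> range normalized_form \<and>
      norm01 \<mu> (\<lambda>j z. \<omega> j z - (\<Sum>e\<in>F. c e * e j z)) < \<epsilon>"
    by (intro exI[of _ F] exI[of _ "\<lambda>e. c (inv normalized_form e)"])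
qed

section \<open>Extension of the solution operator by continuity\<close>

text \<open>
  A Hilbert-Schmidt bound is a norm bound: at each point \<open>z\<close> apply the Cauchy-Schwarz inequality
  to the expansion of \<open>p\<close> in normalized monomial forms, then integrate over \<open>z\<close>.
\<close>
lemma canonical_solution_bounded:
  assumes B: "\<And>F. finite F \<Longrightarrow> (\<Sum>x\<in>F. hs_term (fst x) (snd x)) \<le> B"
    and p: "p \<in> polynomial_forms"
  shows "L2_norm \<mu> (canonical_solution_operator \<mu> p) \<le> sqrt B * norm01 \<mu> p"
proof -
  let ?S = "canonical_solution_operator \<mu>"
  obtain A where A: "finite A"
    and coeff: "\<And>j z. p j z = (\<Sum>\<alpha>\<in>A. coefficient (p j) \<alpha> * monomial \<alpha> z)"
    and expand: "\<And>j z. p j z = (\<Sum>x\<in>A \<times> UNIV. coefficient (p (snd x)) (fst x) * monomial_form (fst x) (snd x) j z)"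
    by (rule polynomial_form_expansion[OF p]) (rule that)
  let ?K = "A \<times> (UNIV :: 'n set)"
  define c where "c x = coefficient (p (snd x)) (fst x)" for x
  have "finite ?K"
    using A by simp
  have p_eq: "p = (\<lambda>j z. \<Sum>x\<in>?K. c x * monomial_form (fst x) (snd x) j z)"
    unfolding c_def by (intro ext) (rule expand)
  have norm_p: "(norm01 \<mu> p)\<^sup>2 = (\<Sum>x\<in>?K. (cmod (c x))\<^sup>2 * sqnorm (fst x))"
  proof -
    have "(L2_norm \<mu> (p j))\<^sup>2 = (\<Sum>\<alpha>\<in>A. (cmod (c (\<alpha>, j)))\<^sup>2 * sqnorm \<alpha>)" for j
    proof -
      have "p j = (\<lambda>z. \<Sum>\<alpha>\<in>A. c (\<alpha>, j) * monomial \<alpha> z)"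
        by (intro ext) (simp only: c_def fst_conv snd_conv coeff[symmetric])
      then show ?thesis
        using A by (simp add: L2_norm_monomial_combination)
    qed
    then show ?thesis
      unfolding norm01_power2 by (simp add: sum.cartesian_product' sum.swap[of _ A UNIV])
  qed
  have "AE z in \<mu>. ?S p z = (\<Sum>x\<in>?K. c x * ?S (monomial_form (fst x) (snd x)) z)"
    unfolding p_eq
    using canonical_solution_linear polynomial_forms_combination zero_in_polynomial_forms
      \<open>finite ?K\<close> monomial_form_in_polynomial_forms
    by (rule linear_operator_on_sum[where v = "\<lambda>x. monomial_form (fst x) (snd x)", THEN conjunct2])
  moreover have "AE z in \<mu>. \<forall>x\<in>?K. ?S (monomial_form (fst x) (snd x)) z = solution (fst x) (snd x) z"
    using \<open>finite ?K\<close> by (intro AE_finite_allI canonical_solution_monomial_form)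
  ultimately have AE: "AE z in \<mu>. ?S p z = (\<Sum>x\<in>?K. c x * solution (fst x) (snd x) z)"
    by eventually_elim simp
  have S_L2: "?S p \<in> L2 \<mu>"
    using canonical_solution_linear p by (simp add: linear_operator_on_def)
  have pointwise: "(cmod (\<Sum>x\<in>?K. c x * solution (fst x) (snd x) z))\<^sup>2
      \<le> (norm01 \<mu> p)\<^sup>2 * (\<Sum>x\<in>?K. (cmod (solution (fst x) (snd x) z))\<^sup>2 / sqnorm (fst x))" for z
  proof -
    have pos: "0 < sqrt (sqnorm \<alpha>)" for \<alpha>
      using sqnorm_pos[of \<alpha>] by simp
    have "cmod (\<Sum>x\<in>?K. c x * solution (fst x) (snd x) z)
        \<le> (\<Sum>x\<in>?K. (cmod (c x) * sqrt (sqnorm (fst x)))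
            * (cmod (solution (fst x) (snd x) z) / sqrt (sqnorm (fst x))))"
      using less_imp_neq[OF pos] by (intro sum_norm_le) (simp add: norm_mult)
    then have "(cmod (\<Sum>x\<in>?K. c x * solution (fst x) (snd x) z))\<^sup>2
        \<le> (\<Sum>x\<in>?K. (cmod (c x) * sqrt (sqnorm (fst x)))
            * (cmod (solution (fst x) (snd x) z) / sqrt (sqnorm (fst x))))\<^sup>2"
      by (rule power_mono) simp
    also have "\<dots> \<le> (\<Sum>x\<in>?K. (cmod (c x) * sqrt (sqnorm (fst x)))\<^sup>2)
        * (\<Sum>x\<in>?K. (cmod (solution (fst x) (snd x) z) / sqrt (sqnorm (fst x)))\<^sup>2)"
      by (rule Cauchy_Schwarz_ineq_sum)
    finally show ?thesis
      using sqnorm_pos by (simp add: norm_p power_mult_distrib power_divide less_imp_le)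
  qed
  have int: "integrable \<mu> (\<lambda>z. (cmod (solution (fst x) (snd x) z))\<^sup>2 / sqnorm (fst x))" for x
    by (intro integrable_divide L2_integrable_square solution_L2)
  have "(L2_norm \<mu> (?S p))\<^sup>2 = (LINT z|\<mu>. (cmod (\<Sum>x\<in>?K. c x * solution (fst x) (snd x) z))\<^sup>2)"
    using L2_norm_cong_AE[OF S_L2 _ AE] by (simp add: L2_norm_power2)
  also have "\<dots> \<le> (LINT z|\<mu>. (norm01 \<mu> p)\<^sup>2
      * (\<Sum>x\<in>?K. (cmod (solution (fst x) (snd x) z))\<^sup>2 / sqnorm (fst x)))"
  proof (rule integral_mono)
    show "integrable \<mu> (\<lambda>z. (cmod (\<Sum>x\<in>?K. c x * solution (fst x) (snd x) z))\<^sup>2)"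
      by (intro L2_integrable_square L2_sum L2_cmult solution_L2)
    show "integrable \<mu> (\<lambda>z. (norm01 \<mu> p)\<^sup>2
        * (\<Sum>x\<in>?K. (cmod (solution (fst x) (snd x) z))\<^sup>2 / sqnorm (fst x)))"
      using int by (intro integrable_mult_right Bochner_Integration.integrable_sum)
  qed (rule pointwise)
  also have "\<dots> = (norm01 \<mu> p)\<^sup>2 * (\<Sum>x\<in>?K. hs_term (fst x) (snd x))"
    using int by (simp add: hs_term_def L2_norm_power2)
  also have "\<dots> \<le> (norm01 \<mu> p)\<^sup>2 * B"
    using B[OF \<open>finite ?K\<close>] by (intro mult_left_mono) simp_all
  finally have "L2_norm \<mu> (?S p) \<le> sqrt ((norm01 \<mu> p)\<^sup>2 * B)"
    by (rule real_le_rsqrt)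
  then show ?thesis
    by (simp add: real_sqrt_mult mult.commute)
qed

text \<open>
  The estimate characterizes the value at \<open>\<omega>\<close> of the continuous extension without reference to an
  approximating sequence, so linearity, boundedness and the extension property of the operator
  can be read off from it. The value is the limit of the solutions for polynomial forms
  \<open>p m\<close> tending to \<open>\<omega>\<close>.
\<close>
lemma canonical_solution_extension_value:
  assumes C: "\<And>p. p \<in> polynomial_forms \<Longrightarrow> L2_norm \<mu> (canonical_solution_operator \<mu> p) \<le> C * norm01 \<mu> p"
    and "0 \<le> C" and \<omega>: "\<omega> \<in> A2_01 \<mu>"
  shows "\<exists>f\<in>L2 \<mu>. \<forall>p\<in>polynomial_forms.
    L2_norm \<mu> (\<lambda>z. f z - canonical_solution_operator \<mu> p z) \<le> C * norm01 \<mu> (\<lambda>j z. \<omega> j z - p j z)"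
proof -
  let ?S = "canonical_solution_operator \<mu>"
  have S_L2: "?S p \<in> L2 \<mu>" if "p \<in> polynomial_forms" for p
    using canonical_solution_linear that by (simp add: linear_operator_on_def)
  have form_L2: "p j \<in> L2 \<mu>" if "p \<in> polynomial_forms" for p j
    using that by (simp add: A2_01_L2 polynomial_form_A2_01)
  have diff: "L2_norm \<mu> (\<lambda>z. ?S p z - ?S q z)
      \<le> C * (norm01 \<mu> (\<lambda>j z. \<omega> j z - p j z) + norm01 \<mu> (\<lambda>j z. \<omega> j z - q j z))"
    if p: "p \<in> polynomial_forms" and q: "q \<in> polynomial_forms" for p q
  proof -
    define h where "h = (\<lambda>j w. 1 * p j w + (- 1) * q j w)"
    have h: "h \<in> polynomial_forms"
      unfolding h_def by (intro polynomial_forms_combination p q)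
    have "AE z in \<mu>. ?S h z = 1 * ?S p z + (- 1) * ?S q z"
      unfolding h_def by (intro linear_operator_onD[OF canonical_solution_linear] p q)
    then have "AE z in \<mu>. ?S p z - ?S q z = ?S h z"
      by eventually_elim simp
    then have "L2_norm \<mu> (\<lambda>z. ?S p z - ?S q z) = L2_norm \<mu> (?S h)"
      by (intro L2_norm_cong_AE L2_diff S_L2 p q h)
    also have "\<dots> \<le> C * norm01 \<mu> h"
      by (rule C[OF h])
    also have "h = (\<lambda>j z. (\<omega> j z - q j z) + (p j z - \<omega> j z))"
      by (simp add: h_def)
    also have "norm01 \<mu> \<dots> \<le> norm01 \<mu> (\<lambda>j z. \<omega> j z - q j z) + norm01 \<mu> (\<lambda>j z. p j z - \<omega> j z)"
      by (intro norm01_triangle L2_diff form_L2 p q A2_01_L2 \<omega>)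
    finally show ?thesis
      using \<open>0 \<le> C\<close> by (simp add: norm01_minus_commute[of \<mu> p] add.commute mult_left_mono)
  qed
  have "\<exists>p. p \<in> polynomial_forms \<and> norm01 \<mu> (\<lambda>j z. \<omega> j z - p j z) < 1 / real (Suc m)" for m
    using polynomial_forms_dense[OF \<omega>, of "1 / real (Suc m)"] by auto
  then obtain p where p: "\<And>m. p m \<in> polynomial_forms"
    and p_less: "\<And>m. norm01 \<mu> (\<lambda>j z. \<omega> j z - p m j z) < 1 / real (Suc m)"
    by metis
  have p_lim: "(\<lambda>m. norm01 \<mu> (\<lambda>j z. \<omega> j z - p m j z)) \<longlonglongrightarrow> 0"
    by (rule real_tendsto_sandwich[OF _ _ tendsto_const LIMSEQ_Suc[OF lim_1_over_n]])
      (use p_less in \<open>auto intro: always_eventually less_imp_le\<close>)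
  have Cauchy: "\<exists>N. \<forall>m\<ge>N. \<forall>n\<ge>N. L2_norm \<mu> (\<lambda>z. ?S (p m) z - ?S (p n) z) < \<epsilon>" if "0 < \<epsilon>" for \<epsilon>
  proof -
    define \<delta> where "\<delta> = \<epsilon> / (C + 1) / 2"
    have "0 < \<delta>"
      using that \<open>0 \<le> C\<close> by (simp add: \<delta>_def)
    then obtain N where N: "\<And>m. m \<ge> N \<Longrightarrow> norm01 \<mu> (\<lambda>j z. \<omega> j z - p m j z) < \<delta>"
      using LIMSEQ_D[OF p_lim] by fastforce
    have "L2_norm \<mu> (\<lambda>z. ?S (p m) z - ?S (p n) z) < \<epsilon>" if "N \<le> m" "N \<le> n" for m n
    proof -
      have "L2_norm \<mu> (\<lambda>z. ?S (p m) z - ?S (p n) z) \<le> C * (\<delta> + \<delta>)"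
        using N[OF that(1)] N[OF that(2)] \<open>0 \<le> C\<close>
        by (intro order_trans[OF diff[OF p p]] mult_left_mono add_mono) auto
      also have "\<dots> < (C + 1) * (\<delta> + \<delta>)"
        using \<open>0 < \<delta>\<close> by simp
      also have "\<dots> = \<epsilon>"
        using \<open>0 \<le> C\<close> by (simp only: \<delta>_def field_sum_of_halves) simp
      finally show ?thesis .
    qed
    then show ?thesis
      by blast
  qed
  obtain f where f: "f \<in> L2 \<mu>" "(\<lambda>m. L2_norm \<mu> (\<lambda>z. f z - ?S (p m) z)) \<longlonglongrightarrow> 0"
    using L2_complete[OF finite_measure S_L2[OF p] Cauchy] by blast
  have "L2_norm \<mu> (\<lambda>z. f z - ?S q z) \<le> C * norm01 \<mu> (\<lambda>j z. \<omega> j z - q j z)"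
    if q: "q \<in> polynomial_forms" for q
  proof (rule LIMSEQ_le_const)
    show "(\<lambda>m. L2_norm \<mu> (\<lambda>z. f z - ?S (p m) z)
        + C * (norm01 \<mu> (\<lambda>j z. \<omega> j z - p m j z) + norm01 \<mu> (\<lambda>j z. \<omega> j z - q j z)))
        \<longlonglongrightarrow> C * norm01 \<mu> (\<lambda>j z. \<omega> j z - q j z)"
      using tendsto_add[OF f(2) tendsto_mult[OF tendsto_const tendsto_add[OF p_lim tendsto_const]]]
      by simp
    have "L2_norm \<mu> (\<lambda>z. f z - ?S q z) \<le> L2_norm \<mu> (\<lambda>z. f z - ?S (p m) z)
        + C * (norm01 \<mu> (\<lambda>j z. \<omega> j z - p m j z) + norm01 \<mu> (\<lambda>j z. \<omega> j z - q j z))" for m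
      using L2_norm_triangle_diff[OF f(1) S_L2[OF p] S_L2[OF q]] diff[OF p q]
      by (meson add_left_mono order_trans)
    then show "\<exists>N. \<forall>m\<ge>N. L2_norm \<mu> (\<lambda>z. f z - ?S q z) \<le> L2_norm \<mu> (\<lambda>z. f z - ?S (p m) z)
        + C * (norm01 \<mu> (\<lambda>j z. \<omega> j z - p m j z) + norm01 \<mu> (\<lambda>j z. \<omega> j z - q j z))"
      by blast
  qed
  then show ?thesis
    using f(1) by blast
qed

text \<open>
  Only the estimate of the preceding lemma is used: for polynomial forms take \<open>p = \<omega>\<close>, for
  boundedness \<open>p = 0\<close>, and for linearity compare with nearby polynomial forms, on which the
  operator is linear.
\<close>
lemma canonical_solution_bounded_extension:
  assumes C: "\<And>p. p \<in> polynomial_forms \<Longrightarrow> L2_norm \<mu> (canonical_solution_operator \<mu> p) \<le> C * norm01 \<mu> p"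
    and "0 \<le> C"
  obtains T where "linear_operator_on \<mu> (A2_01 \<mu>) T"
    "\<And>\<omega>. \<omega> \<in> A2_01 \<mu> \<Longrightarrow> L2_norm \<mu> (T \<omega>) \<le> C * norm01 \<mu> \<omega>"
    "\<forall>\<omega>\<in>polynomial_forms. AE z in \<mu>. T \<omega> z = canonical_solution_operator \<mu> \<omega> z"
proof -
  let ?S = "canonical_solution_operator \<mu>"
  have S_L2: "?S p \<in> L2 \<mu>" if "p \<in> polynomial_forms" for p
    using canonical_solution_linear that by (simp add: linear_operator_on_def)
  define approximates where "approximates \<omega> f \<longleftrightarrow> (\<forall>p\<in>polynomial_forms.
    L2_norm \<mu> (\<lambda>z. f z - ?S p z) \<le> C * norm01 \<mu> (\<lambda>j z. \<omega> j z - p j z))" for \<omega> f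
  have "\<exists>f\<in>L2 \<mu>. approximates \<omega> f" if "\<omega> \<in> A2_01 \<mu>" for \<omega>
    unfolding approximates_def using C \<open>0 \<le> C\<close> that by (rule canonical_solution_extension_value)
  then obtain T where T_L2: "\<And>\<omega>. \<omega> \<in> A2_01 \<mu> \<Longrightarrow> T \<omega> \<in> L2 \<mu>"
    and T_approximates: "\<And>\<omega>. \<omega> \<in> A2_01 \<mu> \<Longrightarrow> approximates \<omega> (T \<omega>)"
    by metis
  have T: "L2_norm \<mu> (\<lambda>z. T \<omega> z - ?S p z) \<le> C * norm01 \<mu> (\<lambda>j z. \<omega> j z - p j z)"
    if "\<omega> \<in> A2_01 \<mu>" "p \<in> polynomial_forms" for \<omega> p
    using T_approximates[OF that(1)] that(2) by (simp add: approximates_def)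
  have extends: "\<forall>\<omega>\<in>polynomial_forms. AE z in \<mu>. T \<omega> z = ?S \<omega> z"
  proof
    fix \<omega> :: "'n form01" assume \<omega>: "\<omega> \<in> polynomial_forms"
    have "L2_norm \<mu> (\<lambda>z. T \<omega> z - ?S \<omega> z) \<le> 0"
      using T[OF polynomial_form_A2_01[OF \<omega>] \<omega>] by simp
    then have "L2_norm \<mu> (\<lambda>z. T \<omega> z - ?S \<omega> z) = 0"
      by (simp add: antisym)
    then have "AE z in \<mu>. T \<omega> z - ?S \<omega> z = 0"
      by (intro L2_norm_eq_0_AE L2_diff T_L2 S_L2 polynomial_form_A2_01 \<omega>)
    then show "AE z in \<mu>. T \<omega> z = ?S \<omega> z"
      by simp
  qed
  moreover have "L2_norm \<mu> (T \<omega>) \<le> C * norm01 \<mu> \<omega>" if \<omega>: "\<omega> \<in> A2_01 \<mu>" for \<omega>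
  proof -
    have "AE z in \<mu>. ?S (\<lambda>j w. 0) z = 0"
      using canonical_solution_linear zero_in_polynomial_forms by (rule linear_operator_on_zero)
    then have "AE z in \<mu>. T \<omega> z = T \<omega> z - ?S (\<lambda>j w. 0) z"
      by eventually_elim simp
    then have "L2_norm \<mu> (T \<omega>) = L2_norm \<mu> (\<lambda>z. T \<omega> z - ?S (\<lambda>j w. 0) z)"
      by (intro L2_norm_cong_AE L2_diff T_L2 S_L2 \<omega> zero_in_polynomial_forms)
    then show ?thesis
      using T[OF \<omega> zero_in_polynomial_forms] by simp
  qed
  moreover have "linear_operator_on \<mu> (A2_01 \<mu>) T"
    unfolding linear_operator_on_def
  proof (intro conjI ballI allI)
    fix \<omega> \<eta> a b
    assume \<omega>: "\<omega> \<in> A2_01 \<mu>" and \<eta>: "\<eta> \<in> A2_01 \<mu>"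
    define \<zeta> where "\<zeta> = (\<lambda>j w. a * \<omega> j w + b * \<eta> j w)"
    have \<zeta>: "\<zeta> \<in> A2_01 \<mu>"
      unfolding \<zeta>_def by (intro A2_01_combination \<omega> \<eta>)
    let ?g = "\<lambda>z. T \<zeta> z - (a * T \<omega> z + b * T \<eta> z)"
    have g: "?g \<in> L2 \<mu>"
      by (intro L2_diff L2_add L2_cmult T_L2 \<omega> \<eta> \<zeta>)
    have bound: "L2_norm \<mu> ?g \<le> 2 * C * (cmod a + cmod b) * \<epsilon>" if "0 < \<epsilon>" for \<epsilon>
    proof -
      obtain p where p: "p \<in> polynomial_forms" "norm01 \<mu> (\<lambda>j z. \<omega> j z - p j z) < \<epsilon>"
        using polynomial_forms_dense[OF \<omega> \<open>0 < \<epsilon>\<close>] .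
      obtain q where q: "q \<in> polynomial_forms" "norm01 \<mu> (\<lambda>j z. \<eta> j z - q j z) < \<epsilon>"
        using polynomial_forms_dense[OF \<eta> \<open>0 < \<epsilon>\<close>] .
      define r where "r = (\<lambda>j w. a * p j w + b * q j w)"
      have r: "r \<in> polynomial_forms"
        unfolding r_def by (intro polynomial_forms_combination p q)
      let ?P = "\<lambda>z. T \<omega> z - ?S p z" and ?Q = "\<lambda>z. T \<eta> z - ?S q z" and ?R = "\<lambda>z. T \<zeta> z - ?S r z"
      have PQR: "?P \<in> L2 \<mu>" "?Q \<in> L2 \<mu>" "?R \<in> L2 \<mu>"
        by (intro L2_diff T_L2 S_L2 \<omega> \<eta> \<zeta> p q r)+
      have P: "L2_norm \<mu> ?P \<le> C * \<epsilon>" and Q: "L2_norm \<mu> ?Q \<le> C * \<epsilon>"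
        using T[OF \<omega> p(1)] T[OF \<eta> q(1)] p(2) q(2) \<open>0 \<le> C\<close>
        by (meson less_imp_le mult_left_mono order_trans)+
      have R: "L2_norm \<mu> ?R \<le> C * ((cmod a + cmod b) * \<epsilon>)"
      proof (rule order_trans[OF T[OF \<zeta> r] mult_left_mono[OF _ \<open>0 \<le> C\<close>]])
        have "(\<lambda>j z. \<zeta> j z - r j z) = (\<lambda>j z. a * (\<omega> j z - p j z) + b * (\<eta> j z - q j z))"
          by (simp add: \<zeta>_def r_def algebra_simps)
        then have "norm01 \<mu> (\<lambda>j z. \<zeta> j z - r j z)
            = norm01 \<mu> (\<lambda>j z. a * (\<omega> j z - p j z) + b * (\<eta> j z - q j z))"
          by (rule arg_cong)
        also have "\<dots> \<le> norm01 \<mu> (\<lambda>j z. a * (\<omega> j z - p j z)) + norm01 \<mu> (\<lambda>j z. b * (\<eta> j z - q j z))"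
          by (intro norm01_triangle L2_cmult L2_diff A2_01_L2 polynomial_form_A2_01 \<omega> \<eta> p q)
        also have "\<dots> \<le> cmod a * \<epsilon> + cmod b * \<epsilon>"
          unfolding norm01_cmult using p(2) q(2) by (intro add_mono mult_left_mono) auto
        finally show "norm01 \<mu> (\<lambda>j z. \<zeta> j z - r j z) \<le> (cmod a + cmod b) * \<epsilon>"
          by (simp add: distrib_right)
      qed
      have "AE z in \<mu>. ?S r z = a * ?S p z + b * ?S q z"
        unfolding r_def by (intro linear_operator_onD[OF canonical_solution_linear] p(1) q(1))
      then have "AE z in \<mu>. ?g z = ?R z + (- a * ?P z + - b * ?Q z)"
        by eventually_elim (simp add: algebra_simps)
      then have "L2_norm \<mu> ?g = L2_norm \<mu> (\<lambda>z. ?R z + (- a * ?P z + - b * ?Q z))"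
        by (intro L2_norm_cong_AE g L2_add L2_cmult PQR)
      also have "\<dots> \<le> L2_norm \<mu> ?R + (L2_norm \<mu> (\<lambda>z. - a * ?P z) + L2_norm \<mu> (\<lambda>z. - b * ?Q z))"
        by (intro order_trans[OF L2_norm_triangle] add_left_mono L2_norm_triangle L2_add L2_cmult PQR)
      also have "\<dots> \<le> C * ((cmod a + cmod b) * \<epsilon>) + (cmod a * (C * \<epsilon>) + cmod b * (C * \<epsilon>))"
        unfolding L2_norm_cmult norm_minus_cancel by (intro add_mono mult_left_mono P Q R) auto
      also have "\<dots> = 2 * C * (cmod a + cmod b) * \<epsilon>"
        by (simp add: algebra_simps)
      finally show ?thesis .
    qed
    have "L2_norm \<mu> ?g \<le> 0"
    proof (rule LIMSEQ_le_const)
      show "(\<lambda>n. 2 * C * (cmod a + cmod b) * (1 / real (Suc n))) \<longlonglongrightarrow> 0"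
        using tendsto_mult[OF tendsto_const LIMSEQ_Suc[OF lim_1_over_n]] by simp
      show "\<exists>N. \<forall>n\<ge>N. L2_norm \<mu> ?g \<le> 2 * C * (cmod a + cmod b) * (1 / real (Suc n))"
        by (intro exI allI impI bound) simp
    qed
    then have "L2_norm \<mu> ?g = 0"
      by (simp add: antisym)
    then have "AE z in \<mu>. ?g z = 0"
      using g by (rule L2_norm_eq_0_AE[rotated])
    then show "AE z in \<mu>. T (\<lambda>j w. a * \<omega> j w + b * \<eta> j w) z = a * T \<omega> z + b * T \<eta> z"
      by (simp add: \<zeta>_def)
  qed (rule T_L2)
  ultimately show ?thesis
    using that by blast
qed

section \<open>The criterion\<close>

lemma sum_hs_term_box:
  "(\<Sum>x\<in>{\<alpha>. (\<Sum>a\<in>UNIV. \<alpha> a) \<le> D} \<times> UNIV. hs_term (fst x) (snd x))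
    = real ((CARD('n) + D - 1) choose (CARD('n) - 1)) * (moment \<mu> (D + 1) / moment \<mu> D)"
proof -
  have "(\<Sum>x\<in>{\<alpha>. (\<Sum>a\<in>UNIV. \<alpha> a) \<le> D} \<times> UNIV. hs_term (fst x) (snd x))
      = (\<Sum>\<alpha> | (\<Sum>a\<in>UNIV. \<alpha> a) \<le> D. \<Sum>j\<in>UNIV. hs_term \<alpha> j)"
    by (simp add: sum.cartesian_product')
  also have "\<dots> = (\<Sum>d\<le>D. \<Sum>\<alpha>\<in>{\<alpha> \<in> {\<alpha>. (\<Sum>a\<in>UNIV. \<alpha> a) \<le> D}. (\<Sum>a\<in>UNIV. \<alpha> a) = d}. \<Sum>j\<in>UNIV. hs_term \<alpha> j)"
    by (rule sum.group[symmetric]) (auto simp: finite_degree_le)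
  also have "\<dots> = (\<Sum>d\<le>D. \<Sum>\<alpha> | (\<Sum>a\<in>UNIV. \<alpha> a) = d. \<Sum>j\<in>UNIV. hs_term \<alpha> j)"
    by (intro sum.cong refl) auto
  finally show ?thesis
    by (simp only: sum_hs_term)
qed

text \<open>
  The sequence in question consists of the partial sums of \<open>hs_term\<close> over the multi-indices of
  degree at most \<open>d\<close>. It is increasing, so it converges if and only if all finite sums of
  \<open>hs_term\<close> are bounded. An extension with a Hilbert-Schmidt sum in some basis bounds them by
  that sum; conversely such a bound gives the bounded extension, and the sum is finite in the
  basis of normalized monomial forms.
\<close>
lemma extends_to_hilbert_schmidt_iff:
  "extends_to_hilbert_schmidt \<mu> (canonical_solution_operator \<mu>)
    \<longleftrightarrow> convergent (\<lambda>d. real ((CARD('n) + d - 1) choose (CARD('n) - 1)) * (moment \<mu> (d + 1) / moment \<mu> d))"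
    (is "?lhs \<longleftrightarrow> convergent ?q")
proof
  let ?box = "\<lambda>D. {\<alpha> :: 'n \<Rightarrow> nat. (\<Sum>a\<in>UNIV. \<alpha> a) \<le> D} \<times> (UNIV :: 'n set)"
  have finite_box: "finite (?box D)" for D
    by (simp add: finite_degree_le)
  have "incseq ?q"
  proof (rule incseq_SucI)
    fix D
    have "(\<Sum>x\<in>?box D. hs_term (fst x) (snd x)) \<le> (\<Sum>x\<in>?box (Suc D). hs_term (fst x) (snd x))"
      by (rule sum_mono2[OF finite_box]) (auto simp: hs_term_nonneg)
    then show "?q D \<le> ?q (Suc D)"
      by (simp only: sum_hs_term_box)
  qed
  {
    assume ?lhs
    then obtain T C E where T: "linear_operator_on \<mu> (A2_01 \<mu>) T"
      and extends: "\<forall>\<omega>\<in>polynomial_forms. AE z in \<mu>. T \<omega> z = canonical_solution_operator \<mu> \<omega> z"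
      and C: "\<forall>\<omega>\<in>A2_01 \<mu>. L2_norm \<mu> (T \<omega>) \<le> C * norm01 \<mu> \<omega>"
      and E: "orthonormal_basis_A2_01 \<mu> E" and summable: "(\<lambda>e. (L2_norm \<mu> (T e))\<^sup>2) summable_on E"
      unfolding extends_to_hilbert_schmidt_def hilbert_schmidt_operator_def by blast
    have T_L2: "T \<omega> \<in> L2 \<mu>" if "\<omega> \<in> A2_01 \<mu>" for \<omega>
      using T that by (simp add: linear_operator_on_def)
    have bounded: "L2_norm \<mu> (T \<omega>) \<le> \<bar>C\<bar> * norm01 \<mu> \<omega>" if "\<omega> \<in> A2_01 \<mu>" for \<omega>
      using C that mult_right_mono[OF abs_ge_self norm01_nonneg, of C \<mu> \<omega>] by force
    have "?q D \<le> (\<Sum>\<^sub>\<infinity>e\<in>E. (L2_norm \<mu> (T e))\<^sup>2)" for D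
    proof -
      have "?q D = (\<Sum>x\<in>?box D. (L2_norm \<mu> (T (normalized_form x)))\<^sup>2)"
        by (simp only: sum_hs_term_box extension_norm_normalized_form[OF T_L2 extends])
      also have "\<dots> \<le> (\<Sum>\<^sub>\<infinity>e\<in>E. (L2_norm \<mu> (T e))\<^sup>2)"
        using T bounded abs_ge_zero E summable finite_box normalized_form_A2_01 normalized_form_orthonormal
        by (rule hilbert_schmidt_sum_le)
      finally show ?thesis .
    qed
    then show "convergent ?q"
      using incseq_convergent[OF \<open>incseq ?q\<close>] unfolding convergent_def by blast
  next
    assume "convergent ?q"
    then obtain L where L: "?q \<longlonglongrightarrow> L"
      unfolding convergent_def by blast
    have sum_le: "(\<Sum>x\<in>F. hs_term (fst x) (snd x)) \<le> L" if "finite F" for F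
    proof -
      define D where "D = (\<Sum>x\<in>F. \<Sum>a\<in>UNIV. fst x a)"
      have "F \<subseteq> ?box D"
      proof
        fix x assume "x \<in> F"
        then have "(\<Sum>a\<in>UNIV. fst x a) \<le> D"
          unfolding D_def using \<open>finite F\<close> by (intro member_le_sum) auto
        then show "x \<in> ?box D"
          by (simp add: mem_Times_iff)
      qed
      then have "(\<Sum>x\<in>F. hs_term (fst x) (snd x)) \<le> (\<Sum>x\<in>?box D. hs_term (fst x) (snd x))"
        by (intro sum_mono2 finite_box) (auto simp: hs_term_nonneg)
      also have "\<dots> = ?q D"
        by (rule sum_hs_term_box)
      also have "\<dots> \<le> L"
        using incseq_le[OF \<open>incseq ?q\<close> L] .
      finally show ?thesis .
    qed
    have "0 \<le> L"
      using sum_le[of "{}"] by simp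
    have S_bounded: "L2_norm \<mu> (canonical_solution_operator \<mu> p) \<le> sqrt L * norm01 \<mu> p"
      if "p \<in> polynomial_forms" for p
      using sum_le that by (rule canonical_solution_bounded)
    obtain T where T: "linear_operator_on \<mu> (A2_01 \<mu>) T"
      and bounded: "\<And>\<omega>. \<omega> \<in> A2_01 \<mu> \<Longrightarrow> L2_norm \<mu> (T \<omega>) \<le> sqrt L * norm01 \<mu> \<omega>"
      and extends: "\<forall>\<omega>\<in>polynomial_forms. AE z in \<mu>. T \<omega> z = canonical_solution_operator \<mu> \<omega> z"
      using S_bounded real_sqrt_ge_zero[OF \<open>0 \<le> L\<close>]
      by (rule canonical_solution_bounded_extension) (assumption, rule that)
    have T_L2: "T \<omega> \<in> L2 \<mu>" if "\<omega> \<in> A2_01 \<mu>" for \<omega>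
      using T that by (simp add: linear_operator_on_def)
    have "(\<lambda>x. hs_term (fst x) (snd x)) summable_on UNIV"
      using sum_le by (intro nonneg_bdd_above_summable_on bdd_aboveI2[where M = L]) (auto simp: hs_term_nonneg)
    then have "((\<lambda>e. (L2_norm \<mu> (T e))\<^sup>2) \<circ> normalized_form) summable_on UNIV"
      by (simp add: o_def extension_norm_normalized_form[OF T_L2 extends])
    then have "(\<lambda>e. (L2_norm \<mu> (T e))\<^sup>2) summable_on range normalized_form"
      by (simp add: summable_on_reindex[OF inj_normalized_form])
    then have "hilbert_schmidt_operator \<mu> T"
      unfolding hilbert_schmidt_operator_def
      using T bounded orthonormal_basis_normalized_form by blast
    then show ?lhs
      unfolding extends_to_hilbert_schmidt_def using extends by blast
  }
qed

end

theorem corollary8: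
  fixes \<mu> :: "(complex ^ 'n) measure"
  assumes "sets \<mu> = sets borel"
    and "rotation_invariant \<mu>"
    and "\<And>d. integrable \<mu> (\<lambda>z. norm z ^ (2 * d))"
    and "\<And>d. 0 < moment \<mu> d"
  shows "extends_to_hilbert_schmidt \<mu> (canonical_solution_operator \<mu>) \<longleftrightarrow>
         convergent (\<lambda>d. real ((CARD('n) + d - 1) choose (CARD('n) - 1)) *
                           (moment \<mu> (d + 1) / moment \<mu> d))"
proof -
  interpret rotation_invariant_measure \<mu>
    using assms by unfold_locales
  show ?thesis
    by (rule extends_to_hilbert_schmidt_iff)
qed

end
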